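(* (Dynamic programming principle.) Let $(t,w)\in\mathbb G$ with $t<T$, and let $h>0$ be such that $t+h\le T$. Then $$\rho(t,w)=\inf_{\alpha\in\mathcal A_{t,t+h}}\Big\{\int_t^{t+h}L\bigl(s,x(s),x(s-\tau(s,x(s))),\alpha(s)\bigr)\,ds+\rho(t+h,x_{t+h})\Big\},$$ where $x=x(\cdot\,|\,t,w,\alpha)$ is the trajectory (on $[t-\bar\tau,t+h]$) with initial history $w$ at time $t$ and control $\alpha$. Moreover, if $\alpha^*$ is an optimal control for $(t,w)$, then the infimum over $\alpha\in\mathcal A_{t,t+h}$ of $\int_t^{t+h}L\bigl(s,x(s),x(s-\tau(s,x(s))),\alpha(s)\bigr)\,ds+\rho(t+h,x_{t+h})$, with $x=x(\cdot\,|\,t,w,\alpha)$, is attained by (the restriction to $(t,t+h)$ of) $\alpha^*$.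
   Context: Setting. Let $t_0<T$, $I=[t_0,T]$, $n,m\ge 1$; $A\subset\mathbb R^m$ is nonempty, convex and compact. $\|\cdot\|$ is the Euclidean norm on $\mathbb R^n$; $\|\cdot\|_1,\|\cdot\|_2,\|\cdot\|_\infty,\|\cdot\|_{H^1}$ are the usual $L^1,L^2,L^\infty,H^1$ norms for functions on $[-\bar\tau,0]$ (with $\bar\tau$ introduced in (7) below). $\mathbb G:=I\times\operatorname{Lip}([-\bar\tau,0];\mathbb R^n)$. For $t_0\le t<s\le T$, $\mathcal A_{t,s}$ is the set of measurable functions $\alpha:(t,s)\to A$. For $R>0$: $P(R)=\{w\in\operatorname{Lip}([-\bar\tau,0];\mathbb R^n):\|w\|_\infty\le R\}$, $V(R)=\{w\in P(R):\|\dot w\|_\infty\le R\}$, $B_R=\{x\in\mathbb R^n:\|x\|\le R\}$. $\mathcal X=\{(z,w):w\in\operatorname{Lip}([-\bar\tau,0];\mathbb R^n),\ z=w(0)\}$ with norm $\|(z,w)\|_{\mathcal X}=\|z\|+\|w\|_1$. Standing assumptions. (1) $f:I\times\mathbb R^n\times\mathbb R^n\times A\to\mathbb R^n$ and $L:I\times\mathbb R^n\times\mathbb R^n\times A\to\mathbb R$ are continuous. (2) There is $\lambda_f>0$ with $\|f(t,z,y,a)-f(t,z',y',a)\|\le\lambda_f(\|z-z'\|+\|y-y'\|)$ for all arguments, and hence $\|f(t,z,y,a)\|\le C_f(1+\|z\|+\|y\|)$ for some fixed $C_f>0$. (3) For every $(t,z,y)$ the set $\{(f(t,z,y,a),\ell)\in\mathbb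 R^n\times\mathbb R:a\in A,\ \ell\ge L(t,z,y,a)\}$ is convex. (4) For every $R>0$ there is $\lambda_L(R)>0$ with $|L(t,z,y,a)-L(t,z',y',a)|\le\lambda_L(R)(\|z-z'\|+\|y-y'\|)$ for $t\in I$, $a\in A$, $z,y,z',y'\in B_R$. (5) There is $C_L>0$ with $|L(t,z,y,a)|\le C_L(1+\|z\|+\|y\|)$ for all arguments. (6) $g:\mathcal X\to\mathbb R$ and for every $R>0$ there is $\lambda_g(R)>0$ with $|g(z_1,w_1)-g(z_2,w_2)|\le\lambda_g(R)\|(z_1,w_1)-(z_2,w_2)\|_{\mathcal X}$ for all $(z_i,w_i)\in\mathcal X$ with $w_i\in P(R)$. (7) $\tau:I\times\mathbb R^n\to[0,\infty)$ is $C^1$ with supremum $\bar\tau<\infty$, and there is $\lambda_\tau>0$ with $|\tau(t,z)-\tau(t,y)|\le\lambda_\tau\|z-y\|$ for all $t\in I$, $z,y\in\mathbb R^n$. State equation. For $(t,w)\in\mathbb G$ and $\alpha\in\mathcal A_{t,T}$, $x(\cdot\,|\,t,w,\alpha)$ denotes the unique Lipschitz $x:[t-\bar\tau,T]\to\mathbb R^n$ with $\dot x(s)=f(s,x(s),x(s-\tau(s,x(s))),\alpha(s))$ for a.e. $s\in(t,T)$ and $x(t+\theta)=w(\theta)$ for $\theta\in[-\bar\tau,0]$ (it exists and is unique under (1)-(7); similarly on a shorter interval $[t,t']$ for $\alpha\in\mathcal A_{t,t'}$). Write $x_s(\theta)=x(s+\theta)$, $\theta\in[-\bar\tau,0]$.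 (8) (Monotone delay) For every $r>0$ there is $d(r)>0$ such that for every such solution with $t\in I$, $w\in P(r)$, $\alpha\in\mathcal A_{t,T}$: $1-\tau_t(s,x(s))-\tau_z(s,x(s))\cdot\dot x(s)\ge d(r)$ for a.e. $s\in[t,T]$. Cost and value. $J(t,w,\alpha)=\int_t^TL(s,x(s),x(s-\tau(s,x(s))),\alpha(s))\,ds+g(x(T),x_T)$ with $x=x(\cdot\,|\,t,w,\alpha)$, and $\rho(t,w)=\inf_{\alpha\in\mathcal A_{t,T}}J(t,w,\alpha)$; for $t=T$ this means $\rho(T,w)=g(w(0),w)$. $\alpha\in\mathcal A_{t,T}$ is an optimal control for $(t,w)$ if the infimum is attained at $\alpha$. *)

theory Defs
  imports "HOL-Analysis.Analysis"
begin

text \<open>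
  Throughout, the real parameter \<open>r\<close> is the maximal delay. A history on \<open>[-r, 0]\<close> is represented
  by a total function, and only its values on \<open>{-r..0}\<close> are meaningful.
\<close>

definition lip_hist :: "real \<Rightarrow> (real \<Rightarrow> 'a::euclidean_space) set" where
  "lip_hist r = {w. \<exists>C. C-lipschitz_on {-r..0} w}"

text \<open>
  Only applied to Lipschitz functions, for which the supremum is the \<open>L\<^sup>\<infinity>\<close> norm when \<open>r > 0\<close>;
  for \<open>r = 0\<close> it is the norm of the single value \<open>w 0\<close>.
\<close>

definition hist_sup_norm :: "real \<Rightarrow> (real \<Rightarrow> 'a::euclidean_space) \<Rightarrow> real" where
  "hist_sup_norm r w = (SUP \<theta>\<in>{-r..0}. norm (w \<theta>))"

definition hist_L1_norm :: "real \<Rightarrow> (real \<Rightarrow> 'a::euclidean_space) \<Rightarrow> real" where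
  "hist_L1_norm r w = (LINT \<theta>:{-r..0}|lebesgue. norm (w \<theta>))"

definition lip_hist_ball :: "real \<Rightarrow> real \<Rightarrow> (real \<Rightarrow> 'a::euclidean_space) set" where
  "lip_hist_ball r R = {w \<in> lip_hist r. hist_sup_norm r w \<le> R}"

definition state_space :: "real \<Rightarrow> ('a::euclidean_space \<times> (real \<Rightarrow> 'a)) set" where
  "state_space r = {(z, w). w \<in> lip_hist r \<and> z = w 0}"

definition state_dist ::
    "real \<Rightarrow> 'a::euclidean_space \<times> (real \<Rightarrow> 'a) \<Rightarrow> 'a \<times> (real \<Rightarrow> 'a) \<Rightarrow> real" where
  "state_dist r p q =
     norm (fst p - fst q) + hist_L1_norm r (\<lambda>\<theta>. snd p \<theta> - snd q \<theta>)"

text \<open>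
  Controls are likewise total functions whose values outside the open interval are irrelevant.
  Measurability is Lebesgue measurability; hence the integrals below are with respect to
  \<open>lebesgue\<close> and not \<open>lborel\<close>.
\<close>

definition controls :: "'b::euclidean_space set \<Rightarrow> real \<Rightarrow> real \<Rightarrow> (real \<Rightarrow> 'b) set" where
  "controls A t s = {\<alpha> \<in> {t<..<s} \<rightarrow> A. \<alpha> \<in> borel_measurable (lebesgue_on {t<..<s})}"

definition hist :: "(real \<Rightarrow> 'a) \<Rightarrow> real \<Rightarrow> real \<Rightarrow> 'a" where
  "hist x s = (\<lambda>\<theta>. x (s + \<theta>))"

definition is_trajectory ::
    "(real \<Rightarrow> 'a::euclidean_space \<Rightarrow> 'a \<Rightarrow> 'b::euclidean_space \<Rightarrow> 'a) \<Rightarrow> (real \<Rightarrow> 'a \<Rightarrow> real) \<Rightarrow> real \<Rightarrow>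
     real \<Rightarrow> real \<Rightarrow> (real \<Rightarrow> 'a) \<Rightarrow> (real \<Rightarrow> 'b) \<Rightarrow> (real \<Rightarrow> 'a) \<Rightarrow> bool" where
  "is_trajectory f \<tau> r t t' w \<alpha> x \<longleftrightarrow>
     (\<exists>C. C-lipschitz_on {t - r..t'} x) \<and>
     (AE s in lebesgue_on {t<..<t'}.
        (x has_vector_derivative f s (x s) (x (s - \<tau> s (x s))) (\<alpha> s)) (at s)) \<and>
     (\<forall>\<theta>\<in>{-r..0}. x (t + \<theta>) = w \<theta>)"

text \<open>
  The solution on \<open>[t - r, t']\<close>; \<open>extensional\<close> fixes the values outside this interval, so
  that the solution is unique as a total function.
\<close>

definition trajectory ::
    "(real \<Rightarrow> 'a::euclidean_space \<Rightarrow> 'a \<Rightarrow> 'b::euclidean_space \<Rightarrow> 'a) \<Rightarrow> (real \<Rightarrow> 'a \<Rightarrow> real) \<Rightarrow> real \<Rightarrow>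
     real \<Rightarrow> real \<Rightarrow> (real \<Rightarrow> 'a) \<Rightarrow> (real \<Rightarrow> 'b) \<Rightarrow> real \<Rightarrow> 'a" where
  "trajectory f \<tau> r t t' w \<alpha> =
     (THE x. x \<in> extensional {t - r..t'} \<and> is_trajectory f \<tau> r t t' w \<alpha> x)"

definition running_cost ::
    "(real \<Rightarrow> 'a::euclidean_space \<Rightarrow> 'a \<Rightarrow> 'b::euclidean_space \<Rightarrow> real) \<Rightarrow> (real \<Rightarrow> 'a \<Rightarrow> real) \<Rightarrow>
     real \<Rightarrow> real \<Rightarrow> (real \<Rightarrow> 'a) \<Rightarrow> (real \<Rightarrow> 'b) \<Rightarrow> real" where
  "running_cost L \<tau> t t' x \<alpha> =
     (LINT s:{t<..<t'}|lebesgue. L s (x s) (x (s - \<tau> s (x s))) (\<alpha> s))"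

definition total_cost ::
    "real \<Rightarrow> (real \<Rightarrow> 'a::euclidean_space \<Rightarrow> 'a \<Rightarrow> 'b::euclidean_space \<Rightarrow> 'a) \<Rightarrow>
     (real \<Rightarrow> 'a \<Rightarrow> 'a \<Rightarrow> 'b \<Rightarrow> real) \<Rightarrow> ('a \<times> (real \<Rightarrow> 'a) \<Rightarrow> real) \<Rightarrow> (real \<Rightarrow> 'a \<Rightarrow> real) \<Rightarrow> real \<Rightarrow>
     real \<Rightarrow> (real \<Rightarrow> 'a) \<Rightarrow> (real \<Rightarrow> 'b) \<Rightarrow> real" where
  "total_cost T f L g \<tau> r t w \<alpha> =
     (let x = trajectory f \<tau> r t T w \<alpha>
      in running_cost L \<tau> t T x \<alpha> + g (x T, hist x T))"

definition value_function ::
    "real \<Rightarrow> 'b::euclidean_space set \<Rightarrow> (real \<Rightarrow> 'a::euclidean_space \<Rightarrow> 'a \<Rightarrow> 'b \<Rightarrow> 'a) \<Rightarrow>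
     (real \<Rightarrow> 'a \<Rightarrow> 'a \<Rightarrow> 'b \<Rightarrow> real) \<Rightarrow> ('a \<times> (real \<Rightarrow> 'a) \<Rightarrow> real) \<Rightarrow> (real \<Rightarrow> 'a \<Rightarrow> real) \<Rightarrow> real \<Rightarrow>
     real \<Rightarrow> (real \<Rightarrow> 'a) \<Rightarrow> real" where
  "value_function T A f L g \<tau> r t w =
     (if t = T then g (w 0, w)
      else (INF \<alpha>\<in>controls A t T. total_cost T f L g \<tau> r t w \<alpha>))"

definition optimal_control ::
    "real \<Rightarrow> 'b::euclidean_space set \<Rightarrow> (real \<Rightarrow> 'a::euclidean_space \<Rightarrow> 'a \<Rightarrow> 'b \<Rightarrow> 'a) \<Rightarrow>
     (real \<Rightarrow> 'a \<Rightarrow> 'a \<Rightarrow> 'b \<Rightarrow> real) \<Rightarrow> ('a \<times> (real \<Rightarrow> 'a) \<Rightarrow> real) \<Rightarrow> (real \<Rightarrow> 'a \<Rightarrow> real) \<Rightarrow> real \<Rightarrow>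
     real \<Rightarrow> (real \<Rightarrow> 'a) \<Rightarrow> (real \<Rightarrow> 'b) \<Rightarrow> bool" where
  "optimal_control T A f L g \<tau> r t w \<alpha> \<longleftrightarrow>
     \<alpha> \<in> controls A t T \<and>
     total_cost T f L g \<tau> r t w \<alpha> = value_function T A f L g \<tau> r t w"

definition dpp_cost ::
    "real \<Rightarrow> 'b::euclidean_space set \<Rightarrow> (real \<Rightarrow> 'a::euclidean_space \<Rightarrow> 'a \<Rightarrow> 'b \<Rightarrow> 'a) \<Rightarrow>
     (real \<Rightarrow> 'a \<Rightarrow> 'a \<Rightarrow> 'b \<Rightarrow> real) \<Rightarrow> ('a \<times> (real \<Rightarrow> 'a) \<Rightarrow> real) \<Rightarrow> (real \<Rightarrow> 'a \<Rightarrow> real) \<Rightarrow> real \<Rightarrow>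
     real \<Rightarrow> real \<Rightarrow> (real \<Rightarrow> 'a) \<Rightarrow> (real \<Rightarrow> 'b) \<Rightarrow> real" where
  "dpp_cost T A f L g \<tau> r t h w \<alpha> =
     (let x = trajectory f \<tau> r t (t + h) w \<alpha>
      in running_cost L \<tau> t (t + h) x \<alpha>
         + value_function T A f L g \<tau> r (t + h) (hist x (t + h)))"

end

theory Submission
  imports Defs
begin

text \<open>
  Restricting a trajectory to \<open>[t, t + h]\<close> and to \<open>[t + h, T]\<close> gives the trajectories for the
  restricted controls, the second one started from the history at time \<open>t + h\<close>. Hence the total
  cost of a control is its running cost up to \<open>t + h\<close> plus the total cost of its tail, and
  minimising over the tail gives both inequalities: a control on \<open>[t, t + h]\<close> and one on
  \<open>[t + h, T]\<close> can be concatenated without leaving the class of measurable controls.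

  This needs existence, uniqueness and a uniform bound for trajectories. They come from the integral
  form of the state equation, which is solved by Picard iteration among functions with a fixed
  Lipschitz constant. The two forms of the equation agree because a Lipschitz function is the
  integral of its almost everywhere derivative (dominated convergence for difference quotients),
  and because an indefinite integral has the integrand as its derivative almost everywhere
  (Henstock's lemma and the Vitali covering theorem).
\<close>

section \<open>Lipschitz functions and indefinite integrals\<close>

text \<open>The delay depends on the state, so \<open>x (s - \<tau> s (x s))\<close> is not
  Lipschitz in \<open>x\<close> for the sup norm: two functions are also read at different times. If
  one of them has Lipschitz constant \<open>K\<close> in time, the shift costs at most
  \<open>K * lt\<close> times their distance. Hence the estimates carry a Lipschitz constant in
  time, and the iteration needs a growth bound that keeps this constant fixed. The uniform bound
  serves the infima: they are taken over sets of reals, so comparing an infimum with one of its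
  members needs a lower bound valid for all controls. No nearly optimal control is constructed;
  attainment follows because the value, the cost at the intermediate time and the total cost are
  squeezed together. Trajectories, histories and controls are total functions with meaningful values
  only on an interval. Two descriptions of the same object may differ elsewhere, which is why
  locality results accompany trajectories and costs.\<close>

text \<open>A bad pair \<open>(s, u)\<close> is a tagged interval on which the Riemann term misses
  the integral by more than \<open>e\<close> times its length. Henstock's lemma bounds the total
  deviation over a disjoint fine family, hence its total length; the Vitali theorem turns this into
  a bound on the outer measure of the bad points \<open>s\<close>.\<close>

lemma negligible_integral_deviation:
  fixes F :: "real \<Rightarrow> 'a::euclidean_space"
  assumes F: "F integrable_on {a..b}" and "0 < e"
  shows "negligible {s \<in> {a<..<b}. \<forall>d>0. \<exists>u\<in>{a<..<b}. 0 < \<bar>u - s\<bar> \<and> \<bar>u - s\<bar> < d \<and>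
           e * \<bar>u - s\<bar> < norm (\<bar>u - s\<bar> *\<^sub>R F s - integral (closed_segment s u) F)}"
    (is "negligible ?E")
proof -
  define bad where "bad s u \<longleftrightarrow>
    e * \<bar>u - s\<bar> < norm (\<bar>u - s\<bar> *\<^sub>R F s - integral (closed_segment s u) F)" for s u
  have "\<exists>T. ?E \<subseteq> T \<and> T \<in> lmeasurable \<and> measure lebesgue T \<le> \<epsilon>" if "\<epsilon> > 0" for \<epsilon>
  proof -
    \<comment> \<open>The half pays for the passage from a segment to the ball around
      \<open>s\<close> that contains it, which is twice as long.\<close>
    have "F integrable_on cbox a b" "0 < e * \<epsilon> / 2"
      using F \<open>0 < e\<close> \<open>\<epsilon> > 0\<close> by auto
    then obtain \<gamma> where "gauge \<gamma>" and \<gamma>: "\<And>p. \<lbrakk>p tagged_partial_division_of (cbox a b); \<gamma> fine p\<rbrakk> \<Longrightarrow>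
        (\<Sum>(x,k)\<in>p. norm (measure lborel k *\<^sub>R F x - integral k F)) < e * \<epsilon> / 2"
      by (rule Henstock_lemma) blast
    define K where "K = {(s, u). s \<in> {a<..<b} \<and> u \<in> {a<..<b} \<and> 0 < \<bar>u - s\<bar> \<and> bad s u \<and>
        closed_segment s u \<subseteq> \<gamma> s}"
    let ?r = "\<lambda>i::real\<times>real. \<bar>snd i - fst i\<bar>"
    have "0 < ?r i" if "i \<in> K" for i
      using that by (auto simp: K_def)
    moreover have "\<exists>i. i \<in> K \<and> s \<in> cball (fst i) (?r i) \<and> ?r i < d" if "s \<in> ?E" "0 < d" for s d
    proof -
      have "s \<in> \<gamma> s" "open (\<gamma> s)"
        using \<open>gauge \<gamma>\<close> by auto
      then obtain \<delta> where "\<delta> > 0" and \<delta>: "ball s \<delta> \<subseteq> \<gamma> s"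
        by (meson open_contains_ball_eq)
      have "min d \<delta> > 0"
        using \<open>0 < d\<close> \<open>\<delta> > 0\<close> by simp
      then obtain u where u: "u \<in> {a<..<b}" "0 < \<bar>u - s\<bar>" "\<bar>u - s\<bar> < min d \<delta>" "bad s u"
        using \<open>s \<in> ?E\<close> unfolding bad_def by blast
      have "closed_segment s u \<subseteq> ball s \<delta>"
        using u \<open>\<delta> > 0\<close> by (intro closed_segment_subset) (auto simp: dist_real_def)
      with \<delta> u \<open>s \<in> ?E\<close> have "(s, u) \<in> K"
        by (auto simp: K_def)
      with u show ?thesis
        by (intro exI[of _ "(s, u)"]) auto
    qed
    ultimately obtain C where C: "countable C" "C \<subseteq> K"
      and disj: "pairwise (\<lambda>i j. disjnt (cball (fst i) (?r i)) (cball (fst j) (?r j))) C"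
      and cov: "negligible (?E - (\<Union>i\<in>C. cball (fst i) (?r i)))"
      by (rule Vitali_covering_theorem_cballs[of K ?r ?E fst]) blast+
    have bound: "measure lebesgue (\<Union>i\<in>D. cball (fst i) (?r i)) \<le> \<epsilon>" if D: "D \<subseteq> C" "finite D" for D
    proof -
      define p where "p = (\<lambda>i. (fst i, closed_segment (fst i) (snd i))) ` D"
      have sub: "closed_segment (fst i) (snd i) \<subseteq> cball (fst i) (?r i)" for i :: "real \<times> real"
        by (intro closed_segment_subset) (auto simp: dist_real_def)
      \<comment> \<open>Disjoint balls have distinct centres, so passing from indices in
        \<open>D\<close> to tagged intervals loses no term of the sum.\<close>
      have inj: "inj_on (\<lambda>i. (fst i, closed_segment (fst i) (snd i))) D"
      proof (rule inj_onI)
        fix i j assume ij: "i \<in> D" "j \<in> D"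
          and "(fst i, closed_segment (fst i) (snd i)) = (fst j, closed_segment (fst j) (snd j))"
        then have "fst i \<in> cball (fst i) (?r i) \<inter> cball (fst j) (?r j)"
          by auto
        then have "\<not> disjnt (cball (fst i) (?r i)) (cball (fst j) (?r j))"
          unfolding disjnt_def by blast
        then show "i = j"
          using disj ij D(1) unfolding pairwise_def by blast
      qed
      have "p tagged_partial_division_of cbox a b"
        unfolding tagged_partial_division_of_def
      proof (intro conjI allI impI)
        show "finite p"
          using D by (simp add: p_def)
      next
        fix x k assume "(x, k) \<in> p"
        then obtain i where i: "i \<in> D" "x = fst i" "k = closed_segment (fst i) (snd i)"
          by (auto simp: p_def)
        then show "x \<in> k" by simp
        have "i \<in> K" using i D C by auto
        then show "k \<subseteq> cbox a b"
          unfolding i by (intro closed_segment_subset) (auto simp: K_def)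
        show "\<exists>a b. k = cbox a b"
          unfolding i closed_segment_eq_real_ivl by (metis box_real(2))
      next
        fix x1 k1 x2 k2 assume "(x1, k1) \<in> p \<and> (x2, k2) \<in> p \<and> (x1, k1) \<noteq> (x2, k2)"
        then obtain i j where ij: "i \<in> D" "j \<in> D" "i \<noteq> j"
          "k1 = closed_segment (fst i) (snd i)" "k2 = closed_segment (fst j) (snd j)"
          by (auto simp: p_def)
        then have "disjnt (cball (fst i) (?r i)) (cball (fst j) (?r j))"
          using disj D(1) unfolding pairwise_def by blast
        then have "k1 \<inter> k2 = {}"
          using sub[of i] sub[of j] ij unfolding disjnt_def by blast
        then show "interior k1 \<inter> interior k2 = {}"
          using interior_subset by blast
      qed
      moreover have "\<gamma> fine p"
      proof (rule fineI)
        fix x k assume "(x, k) \<in> p"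
        then obtain i where "i \<in> D" "x = fst i" "k = closed_segment (fst i) (snd i)"
          by (auto simp: p_def)
        moreover from this have "i \<in> K" using D C by auto
        ultimately show "k \<subseteq> \<gamma> x" by (simp add: K_def case_prod_beta)
      qed
      ultimately have *: "(\<Sum>(x,k)\<in>p. norm (measure lborel k *\<^sub>R F x - integral k F)) < e * \<epsilon> / 2"
        by (rule \<gamma>)
      have "e * (\<Sum>i\<in>D. ?r i) = (\<Sum>i\<in>D. e * ?r i)"
        by (simp add: sum_distrib_left)
      also have "\<dots> \<le> (\<Sum>i\<in>D. norm (?r i *\<^sub>R F (fst i) - integral (closed_segment (fst i) (snd i)) F))"
        using D C by (intro sum_mono less_imp_le) (auto simp: K_def bad_def)
      also have "\<dots> = (\<Sum>(x,k)\<in>p. norm (measure lborel k *\<^sub>R F x - integral k F))"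
        unfolding p_def
        by (subst sum.reindex[OF inj]) (auto simp: closed_segment_eq_real_ivl abs_if intro!: sum.cong)
      also note *
      finally have "(\<Sum>i\<in>D. ?r i) < \<epsilon> / 2"
        using \<open>0 < e\<close> by simp
      moreover have "measure lebesgue (\<Union>i\<in>D. cball (fst i) (?r i))
          \<le> (\<Sum>i\<in>D. measure lebesgue (cball (fst i) (?r i)))"
        using D by (intro measure_UNION_le) auto
      moreover have "\<dots> = (\<Sum>i\<in>D. 2 * ?r i)"
        by (intro sum.cong) (auto simp: cball_eq_atLeastAtMost)
      ultimately show ?thesis
        by (simp add: sum_distrib_left[symmetric])
    qed
    let ?U = "\<Union>i\<in>C. cball (fst i) (?r i)"
    have U: "?U \<in> lmeasurable" "measure lebesgue ?U \<le> \<epsilon>"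
      using fmeasurable_UN_bound[OF C(1) _ bound] measure_UN_bound[OF C(1) _ bound] by auto
    have "?U \<union> (?E - ?U) \<in> lmeasurable"
      using U(1) negligible_imp_measurable[OF cov] by (rule fmeasurable.Un)
    moreover have "measure lebesgue (?U \<union> (?E - ?U)) \<le> \<epsilon>"
      using measure_Un_le[of ?U lebesgue "?E - ?U"] U negligible_imp_measurable[OF cov]
        negligible_imp_measure0[OF cov] by (auto simp: fmeasurableD)
    ultimately show ?thesis
      by (intro exI[of _ "?U \<union> (?E - ?U)"]) blast
  qed
  then show ?thesis
    unfolding negligible_outer_le by blast
qed

text \<open>The exceptional sets for \<open>e = 1/(n+1)\<close> have a null union, and outside it
  the deviation bound is the definition of the derivative. Segments treat points \<open>u\<close> on
  both sides of \<open>s\<close> alike.\<close>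

theorem AE_has_vector_derivative_integral:
  fixes F :: "real \<Rightarrow> 'a::euclidean_space"
  assumes F: "F integrable_on {a..b}"
  shows "AE s in lebesgue_on {a<..<b}. ((\<lambda>u. integral {a..u} F) has_vector_derivative F s) (at s)"
proof -
  define E where "E e = {s \<in> {a<..<b}. \<forall>d>0. \<exists>u\<in>{a<..<b}. 0 < \<bar>u - s\<bar> \<and> \<bar>u - s\<bar> < d \<and>
           e * \<bar>u - s\<bar> < norm (\<bar>u - s\<bar> *\<^sub>R F s - integral (closed_segment s u) F)}" for e
  define N where "N = (\<Union>n. E (inverse (real (Suc n))))"
  have "negligible N"
    unfolding N_def
    using negligible_integral_deviation[OF F]
    by (intro negligible_countable_Union) (auto simp: E_def simp del: of_nat_Suc)
  moreover have "((\<lambda>u. integral {a..u} F) has_vector_derivative F s) (at s)"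
    if s: "s \<in> {a<..<b}" "s \<notin> N" for s
    unfolding has_vector_derivative_def has_derivative_at_alt
  proof (intro conjI allI impI)
    show "bounded_linear (\<lambda>x. x *\<^sub>R F s)"
      by (rule bounded_linear_scaleR_left)
    fix e :: real assume "e > 0"
    then obtain n where n: "inverse (real (Suc n)) < e"
      using reals_Archimedean by blast
    have "s \<notin> E (inverse (real (Suc n)))"
      using s by (auto simp: N_def)
    then obtain d where "d > 0" and d: "\<And>u. \<lbrakk>u \<in> {a<..<b}; 0 < \<bar>u - s\<bar>; \<bar>u - s\<bar> < d\<rbrakk> \<Longrightarrow>
        norm (\<bar>u - s\<bar> *\<^sub>R F s - integral (closed_segment s u) F) \<le> inverse (real (Suc n)) * \<bar>u - s\<bar>"
      using s(1) unfolding E_def by (force simp: not_less)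
    have "norm (integral {a..u} F - integral {a..s} F - (u - s) *\<^sub>R F s) \<le> e * norm (u - s)"
      if u: "norm (u - s) < min d (min (s - a) (b - s))" for u
    proof (cases "u = s")
      case False
      have uab: "u \<in> {a<..<b}"
        using u by (auto simp: abs_if split: if_splits)
      have "norm (integral {a..u} F - integral {a..s} F - (u - s) *\<^sub>R F s) =
          norm (\<bar>u - s\<bar> *\<^sub>R F s - integral (closed_segment s u) F)"
      proof (cases "s < u")
        case True
        have "integral {a..s} F + integral {s..u} F = integral {a..u} F"
          using True s uab by (intro Henstock_Kurzweil_Integration.integral_combine integrable_subinterval_real[OF F]) auto
        then have "integral {a..u} F - integral {a..s} F = integral {s..u} F"
          by (simp add: algebra_simps)
        with True show ?thesis
          by (simp add: closed_segment_eq_real_ivl norm_minus_commute)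
      next
        case False
        have "integral {a..u} F + integral {u..s} F = integral {a..s} F"
          using False s uab by (intro Henstock_Kurzweil_Integration.integral_combine integrable_subinterval_real[OF F]) auto
        then have "integral {a..s} F = integral {a..u} F + integral {u..s} F"
          by simp
        with False \<open>u \<noteq> s\<close> show ?thesis
          by (simp add: closed_segment_eq_real_ivl algebra_simps)
      qed
      also have "\<dots> \<le> inverse (real (Suc n)) * \<bar>u - s\<bar>"
        using False u uab by (intro d) auto
      also have "\<dots> \<le> e * norm (u - s)"
        unfolding real_norm_def using n by (intro mult_right_mono) auto
      finally show ?thesis .
    qed simp
    moreover have "0 < min d (min (s - a) (b - s))"
      using \<open>d > 0\<close> s by auto
    ultimately show "\<exists>d>0. \<forall>y. norm (y - s) < d \<longrightarrow>
        norm (integral {a..y} F - integral {a..s} F - (y - s) *\<^sub>R F s) \<le> e * norm (y - s)"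
      by blast
  qed
  ultimately show ?thesis
    by (subst AE_restrict_space_iff)
      (auto simp: eventually_ae_filter_negligible intro!: exI[of _ N])
qed

section \<open>A Lipschitz function as the integral of its derivative\<close>

lemma has_vector_derivative_imp_quotient_sequence:
  assumes "(y has_vector_derivative D) (at s)"
  shows "(\<lambda>n. real (Suc n) *\<^sub>R (y (s + inverse (real (Suc n))) - y s)) \<longlonglongrightarrow> D"
proof -
  define e where "e n = inverse (real (Suc n))" for n
  have "((\<lambda>h. norm (y (s + h) - y s - h *\<^sub>R D) / norm h) \<longlongrightarrow> 0) (at 0)"
    using assms unfolding has_vector_derivative_def has_derivative_at by blast
  moreover have "filterlim e (at 0) sequentially"
    unfolding filterlim_at e_def using LIMSEQ_inverse_real_of_nat by auto
  ultimately have "(\<lambda>n. norm (y (s + e n) - y s - e n *\<^sub>R D) / norm (e n)) \<longlonglongrightarrow> 0"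
    by (rule filterlim_compose)
  moreover have "norm (y (s + e n) - y s - e n *\<^sub>R D) / norm (e n) =
      norm (real (Suc n) *\<^sub>R (y (s + e n) - y s) - D)" for n
  proof -
    have "real (Suc n) *\<^sub>R (y (s + e n) - y s) - D =
        real (Suc n) *\<^sub>R (y (s + e n) - y s - e n *\<^sub>R D)"
      by (simp add: e_def scaleR_diff_right del: of_nat_Suc)
    then show ?thesis
      by (simp add: e_def divide_inverse del: of_nat_Suc)
  qed
  ultimately have "(\<lambda>n. norm (real (Suc n) *\<^sub>R (y (s + e n) - y s) - D)) \<longlonglongrightarrow> 0"
    by simp
  then have "(\<lambda>n. real (Suc n) *\<^sub>R (y (s + e n) - y s) - D) \<longlonglongrightarrow> 0"
    by (rule tendsto_norm_zero_cancel)
  then show ?thesis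
    unfolding e_def by (rule LIM_zero_cancel)
qed

text \<open>Integrals of forward difference quotients telescope into averages over short intervals
  at \<open>b\<close> and at \<open>a\<close>, which tend to the end values. The Lipschitz constant
  dominates the quotients, so the limit may be taken under the integral.\<close>

lemma Lipschitz_has_integral_derivative:
  fixes x x' :: "real \<Rightarrow> 'a::euclidean_space"
  assumes lip: "K-lipschitz_on {a..b} x" and ab: "a \<le> b"
    and der: "AE s in lebesgue_on {a<..<b}. (x has_vector_derivative x' s) (at s)"
  shows "(x' has_integral (x b - x a)) {a..b}"
proof -
  \<comment> \<open>Constant continuation beyond \<open>[a, b]\<close> defines the forward quotients
    up to \<open>b\<close> and keeps the constant \<open>K\<close>.\<close>
  define y where "y s = x (max a (min b s))" for s
  have K: "0 \<le> K" using lip by (rule lipschitz_on_nonneg)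
  have ylip: "dist (y s) (y s') \<le> K * dist s s'" for s s'
  proof -
    have "dist (y s) (y s') \<le> K * dist (max a (min b s)) (max a (min b s'))"
      unfolding y_def using ab by (intro lipschitz_onD[OF lip]) auto
    also have "\<dots> \<le> K * dist s s'"
      using K by (intro mult_left_mono) (auto simp: dist_real_def)
    finally show ?thesis .
  qed
  have ycont: "continuous_on S y" for S
    by (rule lipschitz_on_continuous_on[of K]) (auto simp: lipschitz_on_def K ylip)
  obtain N where N: "negligible N"
    and derN: "\<And>s. s \<in> {a<..<b} - N \<Longrightarrow> (x has_vector_derivative x' s) (at s)"
    using der by (subst (asm) AE_restrict_space_iff) (auto simp: eventually_ae_filter_negligible)
  have neg: "negligible (N \<union> {a, b})"
    using N by auto
  define q where "q n s = real (Suc n) *\<^sub>R (y (s + inverse (real (Suc n))) - y s)" for n s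
  \<comment> \<open>Zero on the exceptional null set turns convergence almost everywhere into
    convergence at every point, the form in which dominated convergence is applied.\<close>
  define q' where "q' n s = (if s \<in> N \<union> {a, b} then 0 else q n s)" for n s
  define z where "z s = (if s \<in> N \<union> {a, b} then 0 else x' s)" for s
  have qcont: "continuous_on S (q n)" for S n
    unfolding q_def by (intro continuous_intros continuous_on_compose2[OF ycont[of UNIV]]) auto
  have qint: "q n integrable_on {a..b}" for n
    by (intro integrable_continuous_interval qcont)
  have q'int: "q' n integrable_on {a..b}" and q'eq: "integral {a..b} (q' n) = integral {a..b} (q n)" for n
    by (rule integrable_spike[OF qint neg], simp add: q'_def)
      (rule integral_spike[OF neg], simp add: q'_def)
  have bound: "norm (q' n s) \<le> K" for n s
  proof -
    have "norm (q n s) = real (Suc n) * dist (y (s + inverse (real (Suc n)))) (y s)"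
      by (simp add: q_def dist_norm)
    also have "\<dots> \<le> real (Suc n) * (K * dist (s + inverse (real (Suc n))) s)"
      by (intro mult_left_mono ylip) auto
    also have "\<dots> = K"
      by (simp add: dist_real_def)
    finally show ?thesis
      using K by (simp add: q'_def)
  qed
  have lim: "(\<lambda>n. q' n s) \<longlonglongrightarrow> z s" if "s \<in> {a..b}" for s
  proof (cases "s \<in> N \<union> {a, b}")
    case False
    then have s: "s \<in> {a<..<b}" "s \<in> {a<..<b} - N" using that by auto
    have "(y has_vector_derivative x' s) (at s)"
      by (rule has_vector_derivative_transform_within_open[OF derN[OF s(2)] _ s(1)])
        (auto simp: y_def)
    then have "(\<lambda>n. q n s) \<longlonglongrightarrow> x' s"
      unfolding q_def by (rule has_vector_derivative_imp_quotient_sequence)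
    with False show ?thesis by (simp add: q'_def z_def)
  qed (simp add: q'_def z_def)
  have conv: "z integrable_on {a..b}" "(\<lambda>n. integral {a..b} (q' n)) \<longlonglongrightarrow> integral {a..b} z"
    using dominated_convergence[OF q'int integrable_const_ivl[of K] bound lim] by simp_all
  have yint: "y integrable_on {c..d}" for c d
    by (intro integrable_continuous_interval ycont)
  have ival: "integral {a..b} (q n) =
      real (Suc n) *\<^sub>R (integral {b..b + inverse (real (Suc n))} y) -
      real (Suc n) *\<^sub>R (integral {a..a + inverse (real (Suc n))} y)" for n
  proof -
    define \<eta> where "\<eta> = inverse (real (Suc n))"
    have "\<eta> > 0" by (simp add: \<eta>_def)
    have "integral {a..b} (\<lambda>s. y (s + \<eta>)) = integral {a + \<eta>..b + \<eta>} y"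
      using integral_shift[OF ycont, of a b \<eta>] by (simp add: o_def)
    also have "\<dots> = integral {a..b + \<eta>} y - integral {a..a + \<eta>} y"
      using \<open>\<eta> > 0\<close> ab Henstock_Kurzweil_Integration.integral_combine[of a "a + \<eta>" "b + \<eta>" y] yint
      by (simp add: algebra_simps)
    also have "integral {a..b + \<eta>} y = integral {a..b} y + integral {b..b + \<eta>} y"
      using \<open>\<eta> > 0\<close> ab Henstock_Kurzweil_Integration.integral_combine[of a b "b + \<eta>" y] yint
      by simp
    finally have "integral {a..b} (\<lambda>s. y (s + \<eta>)) - integral {a..b} y =
        integral {b..b + \<eta>} y - integral {a..a + \<eta>} y"
      by simp
    moreover have "integral {a..b} (\<lambda>s. y (s + \<eta>) - y s) =
        integral {a..b} (\<lambda>s. y (s + \<eta>)) - integral {a..b} y"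
      by (intro Henstock_Kurzweil_Integration.integral_diff yint integrable_continuous_interval
          continuous_intros continuous_on_compose2[OF ycont[of UNIV]]) auto
    ultimately have "integral {a..b} (\<lambda>s. y (s + \<eta>) - y s) =
        integral {b..b + \<eta>} y - integral {a..a + \<eta>} y"
      by simp
    then show ?thesis
      unfolding q_def \<eta>_def[symmetric] integral_cmul scaleR_diff_right[symmetric] by simp
  qed
  have one_sided: "(\<lambda>n. real (Suc n) *\<^sub>R (integral {c..c + inverse (real (Suc n))} y)) \<longlonglongrightarrow> y c" for c
  proof -
    \<comment> \<open>Starting the integral at \<open>c - 1\<close> makes \<open>c\<close> an
      interior point, so the derivative there is two-sided.\<close>
    have "((\<lambda>u. integral {c - 1..u} y) has_vector_derivative y c) (at c within {c - 1..c + 1})"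
      by (rule integral_has_vector_derivative[OF ycont]) auto
    then have "((\<lambda>u. integral {c - 1..u} y) has_vector_derivative y c) (at c)"
      by (simp add: at_within_Icc_at)
    note has_vector_derivative_imp_quotient_sequence[OF this]
    moreover have "integral {c - 1..c + inverse (real (Suc n))} y - integral {c - 1..c} y =
        integral {c..c + inverse (real (Suc n))} y" for n
      using Henstock_Kurzweil_Integration.integral_combine[of "c - 1" c "c + inverse (real (Suc n))" y] yint
      by (simp add: algebra_simps del: of_nat_Suc)
    ultimately show ?thesis by simp
  qed
  have "(\<lambda>n. integral {a..b} (q n)) \<longlonglongrightarrow> y b - y a"
    unfolding ival by (intro tendsto_diff one_sided)
  then have "integral {a..b} z = x b - x a"
    using LIMSEQ_unique[OF _ conv(2)[unfolded q'eq]] ab by (simp add: y_def)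
  then have "(z has_integral x b - x a) {a..b}"
    using conv(1) by (metis integrable_integral)
  then show ?thesis
    by (rule has_integral_spike[OF neg, rotated]) (auto simp: z_def)
qed

section \<open>Integral estimates for the iteration\<close>

lemma LIMSEQ_halving_mult_zero: "(\<lambda>n. D / 2 ^ n * c) \<longlonglongrightarrow> (0::real)"
  using tendsto_mult_left_zero[OF LIMSEQ_divide_realpow_zero[of 2 D]] by simp

text \<open>The pointwise bound is asked for on the open interval because a control is known to lie
  in \<open>A\<close> only there.\<close>

lemma norm_integral_le_open_interval:
  fixes F :: "real \<Rightarrow> 'a::banach"
  assumes "F integrable_on {a..b}" "(G has_integral I) {a..b}"
    and "\<And>s. s \<in> {a<..<b} \<Longrightarrow> norm (F s) \<le> G s"
  shows "norm (integral {a..b} F) \<le> I"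
proof -
  have "norm (integral {a<..<b} F) \<le> integral {a<..<b} G"
    using assms by (intro Henstock_Kurzweil_Integration.integral_norm_bound_integral)
      (auto simp: integrable_on_open_interval_real)
  then show ?thesis
    using assms(2) by (simp add: integral_open_interval_real[symmetric] integral_unique)
qed

text \<open>The exponential \<open>m s = k * exp (c * (s - t))\<close> solves
  \<open>m' = c * m\<close>, so the integral leaves the surplus \<open>- k\<close>. In the growth
  estimate, with \<open>k = M\<close>, this surplus absorbs the initial value.\<close>

lemma has_integral_exp_linear:
  fixes c k t s :: real
  assumes "t \<le> s"
  shows "((\<lambda>u. c * k * exp (c * (u - t))) has_integral (k * exp (c * (s - t)) - k)) {t..s}"
proof -
  have "((\<lambda>u. c * k * exp (c * (u - t))) has_integral
      (k * exp (c * (s - t)) - k * exp (c * (t - t)))) {t..s}"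
    by (rule fundamental_theorem_of_calculus[OF assms])
      (auto intro!: derivative_eq_intros simp flip: has_real_derivative_iff_has_vector_derivative)
  then show ?thesis by simp
qed

text \<open>The bound is taken at least 1 so that a majorant starting at \<open>M\<close> also
  dominates the constant 1 in the growth condition on \<open>f\<close>.\<close>

lemma lip_hist_bounded:
  assumes "w \<in> lip_hist r"
  obtains M where "M \<ge> 1" "\<And>\<theta>. \<theta> \<in> {-r..0} \<Longrightarrow> norm (w \<theta>) \<le> M"
proof -
  have "continuous_on {-r..0} w"
    using assms unfolding lip_hist_def by (auto intro: lipschitz_on_continuous_on)
  then have "bounded (w ` {-r..0})"
    by (intro compact_imp_bounded compact_continuous_image) auto
  then obtain B where "\<And>\<theta>. \<theta> \<in> {-r..0} \<Longrightarrow> norm (w \<theta>) \<le> B"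
    unfolding bounded_iff by blast
  then show ?thesis
    by (intro that[of "max 1 B"]) (auto simp: le_max_iff_disj)
qed

lemma lipschitz_on_integral:
  fixes F :: "real \<Rightarrow> 'a::banach"
  assumes F: "F integrable_on {a..b}" and bound: "\<And>s. s \<in> {a<..<b} \<Longrightarrow> norm (F s) \<le> K" and "0 \<le> K"
  shows "K-lipschitz_on {a..b} (\<lambda>s. integral {a..s} F)"
proof (rule lipschitz_on_leI)
  fix u s assume us: "u \<in> {a..b}" "s \<in> {a..b}" "u \<le> s"
  have "integral {a..u} F + integral {u..s} F = integral {a..s} F"
    using us by (intro Henstock_Kurzweil_Integration.integral_combine integrable_subinterval_real[OF F]) auto
  then have "dist (integral {a..u} F) (integral {a..s} F) = norm (integral {u..s} F)"
    by (metis add_diff_cancel_left' dist_commute dist_norm)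
  also have "\<dots> \<le> K * (s - u)"
  proof (rule norm_integral_le_open_interval)
    show "F integrable_on {u..s}"
      using us by (intro integrable_subinterval_real[OF F]) auto
    show "((\<lambda>_. K) has_integral K * (s - u)) {u..s}"
      using has_integral_const_real[of K u s] us by (simp add: mult.commute)
  qed (use us bound in auto)
  finally show "dist (integral {a..u} F) (integral {a..s} F) \<le> K * dist u s"
    using us by (simp add: dist_real_def)
qed (rule \<open>0 \<le> K\<close>)

section \<open>Trajectories of the delay equation\<close>

locale delay_dynamics =
  fixes t0 T r :: real and A :: "'b::euclidean_space set"
    and f :: "real \<Rightarrow> 'a::euclidean_space \<Rightarrow> 'a \<Rightarrow> 'b \<Rightarrow> 'a"
    and \<tau> :: "real \<Rightarrow> 'a \<Rightarrow> real"
    and lf lt Cf :: real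
  assumes A_nonempty: "A \<noteq> {}"
    and f_cont: "continuous_on ({t0..T} \<times> UNIV \<times> UNIV \<times> A) (\<lambda>(s, z, y, a). f s z y a)"
    and lf_pos: "0 < lf"
    and f_lip: "\<lbrakk>s \<in> {t0..T}; a \<in> A\<rbrakk> \<Longrightarrow>
        norm (f s z y a - f s z' y' a) \<le> lf * (norm (z - z') + norm (y - y'))"
    and Cf_pos: "0 < Cf"
    and f_growth: "\<lbrakk>s \<in> {t0..T}; a \<in> A\<rbrakk> \<Longrightarrow> norm (f s z y a) \<le> Cf * (1 + norm z + norm y)"
    and \<tau>_cont: "continuous_on ({t0..T} \<times> UNIV) (\<lambda>(s, z). \<tau> s z)"
    and \<tau>_nonneg: "s \<in> {t0..T} \<Longrightarrow> 0 \<le> \<tau> s z"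
    and \<tau>_le: "s \<in> {t0..T} \<Longrightarrow> \<tau> s z \<le> r"
    and lt_nonneg: "0 \<le> lt"
    and \<tau>_lip: "s \<in> {t0..T} \<Longrightarrow> \<bar>\<tau> s z - \<tau> s y\<bar> \<le> lt * norm (z - y)"
begin

text \<open>The value type is free because the dynamics and the running cost are both evaluated
  along a trajectory in this way.\<close>

abbreviation along :: "(real \<Rightarrow> 'a \<Rightarrow> 'a \<Rightarrow> 'b \<Rightarrow> 'c) \<Rightarrow> (real \<Rightarrow> 'a) \<Rightarrow> (real \<Rightarrow> 'b) \<Rightarrow> real \<Rightarrow> 'c" where
  "along F x \<alpha> \<equiv> \<lambda>s. F s (x s) (x (s - \<tau> s (x s))) (\<alpha> s)"

lemma delayed_time_in: "\<lbrakk>t0 \<le> t; t' \<le> T; s \<in> {t..t'}\<rbrakk> \<Longrightarrow> s - \<tau> s z \<in> {t - r..t'}"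
  using \<tau>_nonneg[of s z] \<tau>_le[of s z] by auto

lemma r_nonneg: "t0 \<le> T \<Longrightarrow> 0 \<le> r"
  using \<tau>_nonneg[of t0 0] \<tau>_le[of t0 0] by auto

text \<open>The integrand is a continuous function of a measurable tuple, hence measurable. The
  range of \<open>x\<close> over a compact interval is bounded, so linear growth gives a constant
  majorant. The general \<open>F\<close> covers both \<open>f\<close> and \<open>L\<close>.\<close>

lemma along_absolutely_integrable:
  fixes F :: "real \<Rightarrow> 'a \<Rightarrow> 'a \<Rightarrow> 'b \<Rightarrow> 'c::euclidean_space"
  assumes F_cont: "continuous_on ({t0..T} \<times> UNIV \<times> UNIV \<times> A) (\<lambda>(s, z, y, a). F s z y a)"
    and F_growth: "\<And>s z y a. \<lbrakk>s \<in> {t0..T}; a \<in> A\<rbrakk> \<Longrightarrow> norm (F s z y a) \<le> B * (1 + norm z + norm y)"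
    and "0 \<le> B"
    and t: "t0 \<le> t" "t' \<le> T" and \<alpha>: "\<alpha> \<in> controls A t t'"
    and x: "continuous_on {t - r..t'} x"
  shows "along F x \<alpha> absolutely_integrable_on {t<..<t'}"
proof -
  let ?S = "{t<..<t'}" and ?D = "{t0..T} \<times> UNIV \<times> UNIV \<times> A"
  have sub: "?S \<subseteq> {t - r..t'}"
  proof
    fix s assume s: "s \<in> ?S"
    then have "0 \<le> r" using t by (intro r_nonneg) auto
    with s show "s \<in> {t - r..t'}" by auto
  qed
  have xc: "continuous_on ?S x"
    using x sub by (rule continuous_on_subset)
  have "continuous_on ?S (\<lambda>s. \<tau> s (x s))"
  proof -
    have "(\<lambda>s. (s, x s)) ` ?S \<subseteq> {t0..T} \<times> UNIV"
      using t by auto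
    from continuous_on_compose2[OF \<tau>_cont continuous_on_Pair[OF continuous_on_id xc] this]
    show ?thesis by simp
  qed
  moreover have "(\<lambda>s. s - \<tau> s (x s)) ` ?S \<subseteq> {t - r..t'}"
    by (rule image_subsetI, rule delayed_time_in[OF t]) auto
  ultimately have dc: "continuous_on ?S (\<lambda>s. x (s - \<tau> s (x s)))"
    by (intro continuous_on_compose2[OF x] continuous_intros)
  have "(\<lambda>s. (s, x s, x (s - \<tau> s (x s)), \<alpha> s)) \<in> borel_measurable (lebesgue_on ?S)"
    using \<alpha> unfolding controls_def
    by (intro borel_measurable_Pair[OF _ borel_measurable_Pair[OF _ borel_measurable_Pair]]
        continuous_imp_measurable_on_sets_lebesgue[OF continuous_on_id]
        continuous_imp_measurable_on_sets_lebesgue[OF xc]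
        continuous_imp_measurable_on_sets_lebesgue[OF dc]) auto
  \<comment> \<open>Continuity of \<open>F\<close> is known only on \<open>?D\<close>, so the tuple
    has to be measurable into the restricted space.\<close>
  then have "(\<lambda>s. (s, x s, x (s - \<tau> s (x s)), \<alpha> s)) \<in> measurable (lebesgue_on ?S) (restrict_space borel ?D)"
    using \<alpha> t by (intro measurable_restrict_space2) (auto simp: controls_def)
  from measurable_compose[OF this borel_measurable_continuous_on_restrict[OF F_cont]]
  have meas: "along F x \<alpha> \<in> borel_measurable (lebesgue_on ?S)"
    by simp
  have "bounded (x ` {t - r..t'})"
    by (intro compact_imp_bounded compact_continuous_image x) auto
  then obtain R where R: "\<And>s. s \<in> {t - r..t'} \<Longrightarrow> norm (x s) \<le> R"
    unfolding bounded_iff by blast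
  show ?thesis
  proof (rule measurable_bounded_by_integrable_imp_absolutely_integrable[OF meas])
    show "(\<lambda>_. B * (1 + R + R)) integrable_on ?S"
      unfolding integrable_on_open_interval_real by (rule integrable_const_ivl)
    fix s assume s: "s \<in> ?S"
    have "s \<in> {t..t'}" using s by auto
    from delayed_time_in[OF t this]
    have "norm (x s) \<le> R" "norm (x (s - \<tau> s (x s))) \<le> R"
      using s sub by (auto intro!: R)
    then have "B * (1 + norm (x s) + norm (x (s - \<tau> s (x s)))) \<le> B * (1 + R + R)"
      using \<open>0 \<le> B\<close> by (intro mult_left_mono add_mono) auto
    moreover have "norm (along F x \<alpha> s) \<le> B * (1 + norm (x s) + norm (x (s - \<tau> s (x s))))"
      using \<alpha> t s by (intro F_growth) (auto simp: controls_def)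
    ultimately show "norm (along F x \<alpha> s) \<le> B * (1 + R + R)" by linarith
  qed simp
qed

lemma along_f_integrable:
  assumes "t0 \<le> t" "t' \<le> T" "\<alpha> \<in> controls A t t'" "continuous_on {t - r..t'} x" "{a..b} \<subseteq> {t..t'}"
  shows "along f x \<alpha> integrable_on {a..b}"
proof -
  have "along f x \<alpha> integrable_on {t<..<t'}"
    using along_absolutely_integrable[OF f_cont f_growth _ assms(1-4)] Cf_pos
    by (intro set_lebesgue_integral_eq_integral(1)) auto
  then show ?thesis
    using assms(5) by (auto simp: integrable_on_open_interval_real intro: integrable_subinterval_real)
qed

text \<open>The integral form holds at every time and passes to limits, as the iteration and
  uniqueness require; the derivative form restricts to subintervals without moving the starting
  point. Both sides share the Lipschitz and history conditions, so only the equation itself is at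
  stake.\<close>

lemma is_trajectory_iff_integral_equation:
  assumes t: "t0 \<le> t" "t \<le> t'" "t' \<le> T" and \<alpha>: "\<alpha> \<in> controls A t t'"
  shows "is_trajectory f \<tau> r t t' w \<alpha> x \<longleftrightarrow>
    (\<exists>K. K-lipschitz_on {t - r..t'} x) \<and> (\<forall>\<theta>\<in>{-r..0}. x (t + \<theta>) = w \<theta>) \<and>
    (\<forall>s\<in>{t..t'}. x s = w 0 + integral {t..s} (along f x \<alpha>))"
proof (cases "(\<exists>K. K-lipschitz_on {t - r..t'} x) \<and> (\<forall>\<theta>\<in>{-r..0}. x (t + \<theta>) = w \<theta>)")
  case True
  then obtain K where K: "K-lipschitz_on {t - r..t'} x" by blast
  have r: "0 \<le> r" using t by (intro r_nonneg) auto
  have x0: "x t = w 0" using True r by (metis add.right_neutral atLeastAtMost_iff neg_le_0_iff_le order_refl)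
  have int: "along f x \<alpha> integrable_on {t..t'}"
    using along_f_integrable[OF t(1,3) \<alpha> lipschitz_on_continuous_on[OF K]] by simp
  have "(AE s in lebesgue_on {t<..<t'}. (x has_vector_derivative along f x \<alpha> s) (at s)) \<longleftrightarrow>
      (\<forall>s\<in>{t..t'}. x s = w 0 + integral {t..s} (along f x \<alpha>))" (is "?D \<longleftrightarrow> ?I")
  proof
    assume D: ?D
    show ?I
    proof
      fix s assume s: "s \<in> {t..t'}"
      have "(along f x \<alpha> has_integral (x s - x t)) {t..s}"
      proof (rule Lipschitz_has_integral_derivative)
        show "K-lipschitz_on {t..s} x"
          using K by (rule lipschitz_on_subset) (use s r in auto)
        show "AE u in lebesgue_on {t<..<s}. (x has_vector_derivative along f x \<alpha> u) (at u)"
          using D s by (auto simp: AE_restrict_space_iff elim!: eventually_mono)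
      qed (use s in auto)
      then show "x s = w 0 + integral {t..s} (along f x \<alpha>)"
        by (simp add: integral_unique x0)
    qed
  next
    assume I: ?I
    have "(x has_vector_derivative along f x \<alpha> s) (at s)"
      if "((\<lambda>u. integral {t..u} (along f x \<alpha>)) has_vector_derivative along f x \<alpha> s) (at s)"
        and "s \<in> {t<..<t'}" for s
    proof (rule has_vector_derivative_transform_within_open[of "\<lambda>u. w 0 + integral {t..u} (along f x \<alpha>)" _ _ "{t<..<t'}"])
      show "((\<lambda>u. w 0 + integral {t..u} (along f x \<alpha>)) has_vector_derivative along f x \<alpha> s) (at s)"
        using has_vector_derivative_add[OF has_vector_derivative_const that(1)] by simp
    qed (use that I in auto)
    then show ?D
      using AE_has_vector_derivative_integral[OF int]
      by (auto simp: AE_restrict_space_iff elim!: eventually_mono)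
  qed
  with True show ?thesis
    unfolding is_trajectory_def by blast
qed (auto simp: is_trajectory_def)

section \<open>Contraction estimate and uniqueness\<close>

text \<open>Comparison through the intermediate value \<open>x (s - \<tau> s (y s))\<close> gives
  \<open>K * lt * E\<close> for the shift in time and \<open>E\<close> for the difference of the
  functions there; with \<open>E\<close> for the current state this makes \<open>2 + K * lt\<close>.
  The bound \<open>E\<close> covers the whole past because the delayed time may lie anywhere in
  it.\<close>

lemma along_f_diff_le:
  assumes t: "t0 \<le> t" "t' \<le> T" and s: "s \<in> {t..t'}" "a \<in> A"
    and x: "K-lipschitz_on {t - r..t'} x"
    and le: "\<And>u. u \<in> {t - r..s} \<Longrightarrow> norm (x u - y u) \<le> E"
  shows "norm (f s (x s) (x (s - \<tau> s (x s))) a - f s (y s) (y (s - \<tau> s (y s))) a) \<le> lf * (2 + K * lt) * E"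
proof -
  have K: "0 \<le> K" using x by (rule lipschitz_on_nonneg)
  have r: "0 \<le> r" using t s by (intro r_nonneg) auto
  have sT: "s \<in> {t0..T}" using s t by auto
  have E: "norm (x s - y s) \<le> E"
    using s r by (intro le) auto
  have "norm (x (s - \<tau> s (x s)) - x (s - \<tau> s (y s))) \<le> K * \<bar>\<tau> s (y s) - \<tau> s (x s)\<bar>"
    using lipschitz_onD[OF x delayed_time_in[OF t s(1), of "x s"] delayed_time_in[OF t s(1), of "y s"]]
    by (simp add: dist_norm)
  also have "\<dots> \<le> K * (lt * E)"
  proof (intro mult_left_mono K)
    have "\<bar>\<tau> s (y s) - \<tau> s (x s)\<bar> \<le> lt * norm (y s - x s)"
      by (rule \<tau>_lip[OF sT])
    also have "\<dots> \<le> lt * E"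
      using E lt_nonneg by (intro mult_left_mono) (auto simp: norm_minus_commute)
    finally show "\<bar>\<tau> s (y s) - \<tau> s (x s)\<bar> \<le> lt * E" .
  qed
  finally have 1: "norm (x (s - \<tau> s (x s)) - x (s - \<tau> s (y s))) \<le> K * lt * E"
    by simp
  have "s - \<tau> s (y s) \<in> {t - r..s}"
    using delayed_time_in[OF t s(1)] \<tau>_nonneg[OF sT, of "y s"] by auto
  then have 2: "norm (x (s - \<tau> s (y s)) - y (s - \<tau> s (y s))) \<le> E"
    by (rule le)
  have "norm (x (s - \<tau> s (x s)) - y (s - \<tau> s (y s))) \<le> K * lt * E + E"
    using norm_triangle_le[OF add_mono[OF 1 2]] by simp
  then have "norm (x s - y s) + norm (x (s - \<tau> s (x s)) - y (s - \<tau> s (y s))) \<le> (2 + K * lt) * E"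
    using E by (simp add: algebra_simps)
  then have "lf * (norm (x s - y s) + norm (x (s - \<tau> s (x s)) - y (s - \<tau> s (y s)))) \<le> lf * ((2 + K * lt) * E)"
    using lf_pos by simp
  with f_lip[OF sT s(2)] show ?thesis
    by (simp add: mult.assoc) (meson order_trans)
qed

text \<open>A contraction with factor 1/2 in the weighted norm \<open>SUP s. exp (- \<beta> * (s - t)) * norm (x s)\<close>.
  The Lipschitz constant \<open>K\<close> enters because the two trajectories are read at different delayed times.\<close>

lemma integral_along_f_contraction:
  assumes t: "t0 \<le> t" "t' \<le> T" and \<alpha>: "\<alpha> \<in> controls A t t'"
    and x: "K-lipschitz_on {t - r..t'} x" and y: "K-lipschitz_on {t - r..t'} y"
    and hist: "\<And>u. u \<in> {t - r..t} \<Longrightarrow> x u = y u"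
    and le: "\<And>u. u \<in> {t..t'} \<Longrightarrow> norm (x u - y u) \<le> D * exp (\<beta> * (u - t))"
    and \<beta>: "\<beta> = 2 * lf * (2 + K * lt)"
    and s: "s \<in> {t..t'}"
  shows "norm (integral {t..s} (along f x \<alpha>) - integral {t..s} (along f y \<alpha>)) \<le> D / 2 * exp (\<beta> * (s - t))"
proof -
  have K: "0 \<le> K" using x by (rule lipschitz_on_nonneg)
  have "\<beta> > 0" unfolding \<beta> using lf_pos lt_nonneg K
    by (intro mult_pos_pos add_pos_nonneg mult_nonneg_nonneg) auto
  have r: "0 \<le> r" using t s by (intro r_nonneg) auto
  have D: "0 \<le> D" using order_trans[OF norm_ge_zero le[of t]] s by auto
  have ix: "along f x \<alpha> integrable_on {t..s}" and iy: "along f y \<alpha> integrable_on {t..s}"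
    using s by (intro along_f_integrable[OF t \<alpha>] lipschitz_on_continuous_on[OF x]
        lipschitz_on_continuous_on[OF y]; auto)+
  have "norm (integral {t..s} (along f x \<alpha>) - integral {t..s} (along f y \<alpha>)) =
      norm (integral {t..s} (\<lambda>u. along f x \<alpha> u - along f y \<alpha> u))"
    by (subst Henstock_Kurzweil_Integration.integral_diff[OF ix iy]) simp
  also have "\<dots> \<le> D / 2 * exp (\<beta> * (s - t)) - D / 2"
  proof (rule norm_integral_le_open_interval)
    show "(\<lambda>u. along f x \<alpha> u - along f y \<alpha> u) integrable_on {t..s}"
      by (intro Henstock_Kurzweil_Integration.integrable_diff ix iy)
    show "((\<lambda>u. \<beta> * (D / 2) * exp (\<beta> * (u - t))) has_integral D / 2 * exp (\<beta> * (s - t)) - D / 2) {t..s}"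
      using s by (intro has_integral_exp_linear) auto
    fix u assume u: "u \<in> {t<..<s}"
    have "norm (x v - y v) \<le> D * exp (\<beta> * (u - t))" if v: "v \<in> {t - r..u}" for v
    proof (cases "v \<le> t")
      case True
      then show ?thesis using hist[of v] v D by simp
    next
      case False
      then have "norm (x v - y v) \<le> D * exp (\<beta> * (v - t))"
        using v u s by (intro le) auto
      also have "\<dots> \<le> D * exp (\<beta> * (u - t))"
        using v D \<open>\<beta> > 0\<close> by (intro mult_left_mono) auto
      finally show ?thesis .
    qed
    then have "norm (along f x \<alpha> u - along f y \<alpha> u) \<le> lf * (2 + K * lt) * (D * exp (\<beta> * (u - t)))"
      using u s \<alpha> by (intro along_f_diff_le[OF t _ _ x]) (auto simp: controls_def)
    \<comment> \<open>The constant \<beta> is twice the rate in \<open>along_f_diff_le\<close>: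
      integrating the exponential divides by \<beta> and leaves the factor 1/2.\<close>
    moreover have "lf * (2 + K * lt) * (D * e) = \<beta> * (D / 2) * e" for e
      by (simp add: \<beta>)
    ultimately show "norm (along f x \<alpha> u - along f y \<alpha> u) \<le> \<beta> * (D / 2) * exp (\<beta> * (u - t))"
      by simp
  qed
  finally show ?thesis using D by simp
qed

text \<open>A crude bound \<open>D\<close> on the difference is halved, up to the exponential
  weight, each time both solutions are replaced by their integral equations.\<close>

lemma is_trajectory_unique:
  assumes t: "t0 \<le> t" "t \<le> t'" "t' \<le> T" and \<alpha>: "\<alpha> \<in> controls A t t'"
    and "is_trajectory f \<tau> r t t' w \<alpha> x" "is_trajectory f \<tau> r t t' w \<alpha> y" and s: "s \<in> {t - r..t'}"
  shows "x s = y s"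
proof -
  note eqv = is_trajectory_iff_integral_equation[OF t \<alpha>]
  obtain Kx Ky where "Kx-lipschitz_on {t - r..t'} x" "Ky-lipschitz_on {t - r..t'} y"
    using assms(5,6) eqv by blast
  \<comment> \<open>The Lipschitz constants of two solutions may differ; the contraction is stated
    for a common one.\<close>
  then obtain K where x: "K-lipschitz_on {t - r..t'} x" and y: "K-lipschitz_on {t - r..t'} y"
    using lipschitz_on_mono[OF _ order_refl max.cobounded1] lipschitz_on_mono[OF _ order_refl max.cobounded2]
    by metis
  have hist: "x u = y u" if "u \<in> {t - r..t}" for u
  proof -
    have "u - t \<in> {-r..0}" using that by auto
    then have "x (t + (u - t)) = w (u - t)" "y (t + (u - t)) = w (u - t)"
      using assms(5,6) eqv by blast+
    then show ?thesis by simp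
  qed
  have "bounded ((\<lambda>u. x u - y u) ` {t..t'})"
  proof (intro compact_imp_bounded compact_continuous_image continuous_on_diff)
    have "{t..t'} \<subseteq> {t - r..t'}" using r_nonneg t by auto
    then show "continuous_on {t..t'} x" "continuous_on {t..t'} y"
      using x y by (meson lipschitz_on_continuous_on lipschitz_on_subset)+
  qed auto
  then obtain D where D: "\<And>u. u \<in> {t..t'} \<Longrightarrow> norm (x u - y u) \<le> D"
    unfolding bounded_iff by blast
  define \<beta> where "\<beta> = 2 * lf * (2 + K * lt)"
  have "\<beta> \<ge> 0" unfolding \<beta>_def using lf_pos lt_nonneg lipschitz_on_nonneg[OF x] by auto
  have le: "norm (x u - y u) \<le> D / 2 ^ n * exp (\<beta> * (u - t))" if "u \<in> {t..t'}" for u n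
    using that
  proof (induction n arbitrary: u)
    case 0
    have "D \<ge> 0" using order_trans[OF norm_ge_zero D[OF 0]] .
    then have "D * 1 \<le> D * exp (\<beta> * (u - t))"
      using 0 \<open>\<beta> \<ge> 0\<close> by (intro mult_left_mono) auto
    with D[OF 0] show ?case by simp
  next
    case (Suc n)
    have "norm (x u - y u) = norm (integral {t..u} (along f x \<alpha>) - integral {t..u} (along f y \<alpha>))"
      using assms(5,6) Suc.prems unfolding eqv by simp
    also have "\<dots> \<le> D / 2 ^ n / 2 * exp (\<beta> * (u - t))"
      using Suc by (intro integral_along_f_contraction[OF t(1,3) \<alpha> x y hist _ \<beta>_def])
    finally show ?case by (simp add: mult.commute)
  qed
  show ?thesis
  proof (cases "s \<le> t")
    case False
    then have "s \<in> {t..t'}" using s by auto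
    note le = le[OF this]
    have "(\<lambda>n. D / 2 ^ n * exp (\<beta> * (s - t))) \<longlonglongrightarrow> 0"
      by (rule LIMSEQ_halving_mult_zero)
    then have "norm (x s - y s) \<le> 0"
      by (rule LIMSEQ_le_const) (use le in auto)
    then show ?thesis by simp
  qed (use hist s in auto)
qed

section \<open>Existence by Picard iteration\<close>

text \<open>A class that the Picard map leaves invariant. Its majorant solves
  \<open>m' = 3 * Cf * m\<close> with \<open>m t = M\<close>; \<open>max t s\<close> freezes it at
  \<open>M\<close> on the history.\<close>

definition history_growth :: "real \<Rightarrow> (real \<Rightarrow> 'a) \<Rightarrow> real \<Rightarrow> real \<Rightarrow> real \<Rightarrow> (real \<Rightarrow> 'a) \<Rightarrow> bool" where
  "history_growth t w t' K M x \<longleftrightarrow> K-lipschitz_on {t - r..t'} x \<and> (\<forall>s\<in>{t - r..t}. x s = w (s - t)) \<and>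
     (\<forall>s\<in>{t - r..t'}. norm (x s) \<le> M * exp (3 * Cf * (max t s - t)))"

definition picard :: "real \<Rightarrow> (real \<Rightarrow> 'a) \<Rightarrow> (real \<Rightarrow> 'b) \<Rightarrow> (real \<Rightarrow> 'a) \<Rightarrow> real \<Rightarrow> 'a" where
  "picard t w \<alpha> x s = (if s \<le> t then w (s - t) else w 0 + integral {t..s} (along f x \<alpha>))"

lemma picard_after: "t \<le> s \<Longrightarrow> picard t w \<alpha> x s = w 0 + integral {t..s} (along f x \<alpha>)"
  by (cases "s = t") (auto simp: picard_def)

lemma lipschitz_on_history_extension:
  assumes w: "K-lipschitz_on {-r..0} w" and y: "K-lipschitz_on {t..t'} y" and "y t = w 0"
  shows "K-lipschitz_on {t - r..t'} (\<lambda>s. if s \<le> t then w (s - t) else y s)"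
proof (rule lipschitz_on_concat[OF _ y])
  show "K-lipschitz_on {t - r..t} (\<lambda>s. w (s - t))"
  proof (rule lipschitz_onI)
    fix u s assume "u \<in> {t - r..t}" "s \<in> {t - r..t}"
    then show "dist (w (u - t)) (w (s - t)) \<le> K * dist u s"
      using lipschitz_onD[OF w, of "u - t" "s - t"] by (simp add: dist_real_def)
  qed (rule lipschitz_on_nonneg[OF w])
qed (simp add: assms(3))

text \<open>The majorant is nondecreasing and at least 1, so it dominates each term of
  \<open>1 + norm (x s) + norm (x (s - \<tau> s (x s)))\<close>; hence the factor 3. The right-hand
  side is then at most the derivative of the majorant, and the value of that derivative at
  \<open>t'\<close> bounds the slope, which explains the requirement on \<open>K\<close>.\<close>

lemma history_growth_picard:
  assumes t: "t0 \<le> t" "t \<le> t'" "t' \<le> T" and \<alpha>: "\<alpha> \<in> controls A t t'"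
    and w: "K-lipschitz_on {-r..0} w" and M: "1 \<le> M" "\<And>\<theta>. \<theta> \<in> {-r..0} \<Longrightarrow> norm (w \<theta>) \<le> M"
    and K: "3 * Cf * (M * exp (3 * Cf * (t' - t))) \<le> K"
    and x: "history_growth t w t' K M x"
  shows "history_growth t w t' K M (picard t w \<alpha> x)"
proof -
  let ?m = "\<lambda>s. M * exp (3 * Cf * (s - t))"
  have r: "0 \<le> r" using t by (intro r_nonneg) auto
  have m_mono: "?m u \<le> ?m s" if "u \<le> s" for u s
    using that M Cf_pos by (intro mult_left_mono) auto
  have xK: "K-lipschitz_on {t - r..t'} x" using x by (simp add: history_growth_def)
  have int: "along f x \<alpha> integrable_on {t..s}" if "s \<le> t'" for s
    using along_f_integrable[OF t(1,3) \<alpha> lipschitz_on_continuous_on[OF xK]] that by auto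
  have rhs: "norm (along f x \<alpha> s) \<le> 3 * Cf * ?m s" if s: "s \<in> {t<..<t'}" for s
  proof -
    have sT: "s \<in> {t0..T}" and "\<alpha> s \<in> A"
      using s t \<alpha> by (auto simp: controls_def)
    have "norm (x u) \<le> ?m s" if "u \<in> {t - r..s}" for u
    proof -
      have "norm (x u) \<le> ?m (max t u)"
        using x that s by (auto simp: history_growth_def)
      also have "\<dots> \<le> ?m s"
        using that s by (intro m_mono) auto
      finally show ?thesis .
    qed
    moreover have "s - \<tau> s (x s) \<in> {t - r..s}"
      using \<tau>_nonneg[OF sT, of "x s"] \<tau>_le[OF sT, of "x s"] s by auto
    moreover have "s \<in> {t - r..s}" using s r by auto
    moreover have "1 * 1 \<le> ?m s"
      using s M Cf_pos by (intro mult_mono) auto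
    ultimately have "norm (x s) \<le> ?m s" "norm (x (s - \<tau> s (x s))) \<le> ?m s" "1 \<le> ?m s"
      by auto
    then have le: "1 + norm (x s) + norm (x (s - \<tau> s (x s))) \<le> 3 * ?m s"
      by linarith
    have "norm (along f x \<alpha> s) \<le> Cf * (1 + norm (x s) + norm (x (s - \<tau> s (x s))))"
      by (rule f_growth[OF sT \<open>\<alpha> s \<in> A\<close>])
    also have "\<dots> \<le> Cf * (3 * ?m s)"
      using Cf_pos le by (intro mult_left_mono) auto
    also have "\<dots> = 3 * Cf * ?m s"
      by simp
    finally show ?thesis .
  qed
  have "K-lipschitz_on {t..t'} (\<lambda>s. integral {t..s} (along f x \<alpha>))"
  proof (rule lipschitz_on_integral[OF int])
    fix s assume s: "s \<in> {t<..<t'}"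
    have "3 * Cf * ?m s \<le> 3 * Cf * ?m t'"
      using s Cf_pos by (intro mult_left_mono m_mono) auto
    with rhs[OF s] K show "norm (along f x \<alpha> s) \<le> K" by linarith
  qed (use lipschitz_on_nonneg[OF w] in auto)
  then have "K-lipschitz_on {t..t'} (\<lambda>s. w 0 + integral {t..s} (along f x \<alpha>))"
    by (simp add: lipschitz_on_def)
  then have "K-lipschitz_on {t - r..t'} (picard t w \<alpha> x)"
    unfolding picard_def by (intro lipschitz_on_history_extension[OF w]) auto
  moreover have "norm (picard t w \<alpha> x s) \<le> ?m (max t s)" if s: "s \<in> {t - r..t'}" for s
  proof (cases "s \<le> t")
    case True
    then show ?thesis
      using M(2)[of "s - t"] s by (simp add: picard_def max_def)
  next
    case False
    have "norm (integral {t..s} (along f x \<alpha>)) \<le> M * exp (3 * Cf * (s - t)) - M"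
    proof (rule norm_integral_le_open_interval[OF int has_integral_exp_linear])
      fix u assume "u \<in> {t<..<s}"
      then show "norm (along f x \<alpha> u) \<le> 3 * Cf * M * exp (3 * Cf * (u - t))"
        using rhs[of u] s by simp
    qed (use s False in auto)
    moreover have "norm (w 0) \<le> M"
      using r by (intro M) auto
    ultimately have "norm (w 0 + integral {t..s} (along f x \<alpha>)) \<le> M * exp (3 * Cf * (s - t))"
      by (intro norm_triangle_le) linarith
    with False show ?thesis by (simp add: picard_def)
  qed
  ultimately show ?thesis
    by (simp add: history_growth_def picard_def)
qed

text \<open>The bound depends on the history only through \<open>M\<close> and not on the control;
  this uniformity later bounds the costs from below.\<close>

lemma is_trajectory_exists:
  assumes t: "t0 \<le> t" "t \<le> t'" "t' \<le> T" and \<alpha>: "\<alpha> \<in> controls A t t'"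
    and w: "w \<in> lip_hist r" and M: "1 \<le> M" "\<And>\<theta>. \<theta> \<in> {-r..0} \<Longrightarrow> norm (w \<theta>) \<le> M"
  obtains x where "is_trajectory f \<tau> r t t' w \<alpha> x"
    "\<And>s. s \<in> {t - r..t'} \<Longrightarrow> norm (x s) \<le> M * exp (3 * Cf * (t' - t))"
proof -
  have r: "0 \<le> r" using t by (intro r_nonneg) auto
  define R where "R = M * exp (3 * Cf * (t' - t))"
  obtain K0 where "K0-lipschitz_on {-r..0} w"
    using w by (auto simp: lip_hist_def)
  \<comment> \<open>One constant covers the slope of the history and that of every iterate, since
    the iterates stay bounded by \<open>R\<close>.\<close>
  then obtain K where wK: "K-lipschitz_on {-r..0} w" and K: "3 * Cf * R \<le> K"
    using lipschitz_on_mono[OF _ order_refl, of K0 "{-r..0}" w "max K0 (3 * Cf * R)"] by auto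
  define X where "X n = (picard t w \<alpha> ^^ n) (\<lambda>s. if s \<le> t then w (s - t) else w 0)" for n
  define \<beta> where "\<beta> = 2 * lf * (2 + K * lt)"
  have "\<beta> \<ge> 0" unfolding \<beta>_def using lf_pos lt_nonneg lipschitz_on_nonneg[OF wK] by auto
  have XS: "X (Suc n) = picard t w \<alpha> (X n)" for n by (simp add: X_def)
  have adm: "history_growth t w t' K M (X n)" for n
  proof (induction n)
    case 0
    have "norm (X 0 s) \<le> M * exp (3 * Cf * (max t s - t))" if "s \<in> {t - r..t'}" for s
    proof -
      have "norm (X 0 s) \<le> M * 1"
        using M(2)[of "s - t"] M(2)[of 0] that r by (auto simp: X_def)
      also have "\<dots> \<le> M * exp (3 * Cf * (max t s - t))"
        using M Cf_pos by (intro mult_left_mono) auto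
      finally show ?thesis .
    qed
    moreover have "K-lipschitz_on {t - r..t'} (X 0)"
      unfolding X_def funpow_0
      using lipschitz_on_nonneg[OF wK]
      by (intro lipschitz_on_history_extension[OF wK]) (auto simp: lipschitz_on_def)
    ultimately show ?case
      by (auto simp: history_growth_def X_def)
  next
    case (Suc n)
    then show ?case
      unfolding XS using K by (intro history_growth_picard[OF t \<alpha> wK M]) (auto simp: R_def)
  qed
  have XK: "K-lipschitz_on {t - r..t'} (X n)" for n
    using adm by (simp add: history_growth_def)
  have Xhist: "X n s = w (s - t)" if "s \<in> {t - r..t}" for n s
    using adm[of n] that by (simp add: history_growth_def)
  have XR: "norm (X n s) \<le> R" if "s \<in> {t - r..t'}" for n s
  proof -
    have "norm (X n s) \<le> M * exp (3 * Cf * (max t s - t))"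
      using adm[of n] that by (simp add: history_growth_def)
    also have "\<dots> \<le> R"
      unfolding R_def using that t M Cf_pos by (intro mult_left_mono) auto
    finally show ?thesis .
  qed
  have R0: "0 \<le> R" using M by (simp add: R_def)
  \<comment> \<open>Two functions bounded by \<open>R\<close> differ by at most
    \<open>2 * R\<close>; every further step applies the contraction.\<close>
  have cauchy: "norm (X (n + k) s - X n s) \<le> 2 * R / 2 ^ n * exp (\<beta> * (s - t))" if "s \<in> {t..t'}" for n k s
    using that
  proof (induction n arbitrary: s)
    case 0
    have "norm (X k s - X 0 s) \<le> 2 * R * 1"
      using norm_triangle_le_diff[OF add_mono[OF XR[of s k] XR[of s 0]]] 0 r by auto
    also have "\<dots> \<le> 2 * R * exp (\<beta> * (s - t))"
      using 0 \<open>\<beta> \<ge> 0\<close> R0 by (intro mult_left_mono) auto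
    finally show ?case by simp
  next
    case (Suc n)
    have "norm (X (Suc n + k) s - X (Suc n) s) =
        norm (integral {t..s} (along f (X (n + k)) \<alpha>) - integral {t..s} (along f (X n) \<alpha>))"
      using Suc.prems by (simp add: XS picard_after)
    also have "\<dots> \<le> 2 * R / 2 ^ n / 2 * exp (\<beta> * (s - t))"
      using Suc by (intro integral_along_f_contraction[OF t(1,3) \<alpha> XK XK _ _ \<beta>_def]) (auto simp: Xhist)
    finally show ?case by (simp add: mult.commute)
  qed
  have "Cauchy (\<lambda>n. X n s)" if s: "s \<in> {t..t'}" for s
  proof (rule metric_CauchyI)
    fix e :: real assume "e > 0"
    have "(\<lambda>n. 2 * R / 2 ^ n * exp (\<beta> * (s - t))) \<longlonglongrightarrow> 0"
      by (rule LIMSEQ_halving_mult_zero)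
    then have "eventually (\<lambda>n. 2 * R / 2 ^ n * exp (\<beta> * (s - t)) < e / 2) sequentially"
      using \<open>e > 0\<close> by (intro order_tendstoD) auto
    then obtain N where N: "2 * R / 2 ^ N * exp (\<beta> * (s - t)) < e / 2"
      by (auto simp: eventually_sequentially)
    have *: "dist (X m s) (X N s) < e / 2" if "m \<ge> N" for m
      using cauchy[OF s, of N "m - N"] that N by (simp add: dist_norm)
    show "\<exists>N. \<forall>m\<ge>N. \<forall>n\<ge>N. dist (X m s) (X n s) < e"
      using * by (meson dist_triangle_half_l dist_commute_lessI)
  qed
  moreover have "Cauchy (\<lambda>n. X n s)" if "s \<in> {t - r..t}" for s
    using Xhist[OF that] by (simp add: convergent_Cauchy convergent_const)
  ultimately have "convergent (\<lambda>n. X n s)" if "s \<in> {t - r..t'}" for s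
    using that by (cases "s \<le> t") (auto intro: Cauchy_convergent)
  then obtain x where lim: "\<And>s. s \<in> {t - r..t'} \<Longrightarrow> (\<lambda>n. X n s) \<longlonglongrightarrow> x s"
    unfolding convergent_def by metis
  have xK: "K-lipschitz_on {t - r..t'} x"
  proof (rule lipschitz_onI)
    fix u s assume us: "u \<in> {t - r..t'}" "s \<in> {t - r..t'}"
    have "(\<lambda>n. dist (X n u) (X n s)) \<longlonglongrightarrow> dist (x u) (x s)"
      using us by (intro tendsto_dist lim)
    then show "dist (x u) (x s) \<le> K * dist u s"
      by (rule LIMSEQ_le_const2) (use lipschitz_onD[OF XK us] in auto)
  qed (rule lipschitz_on_nonneg[OF wK])
  have xhist: "x s = w (s - t)" if "s \<in> {t - r..t}" for s
    using lim[of s] that t LIMSEQ_unique[of "\<lambda>n. X n s"] by (simp add: Xhist)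
  have xX: "norm (x s - X n s) \<le> 2 * R / 2 ^ n * exp (\<beta> * (s - t))" if s: "s \<in> {t..t'}" for n s
  proof -
    have "(\<lambda>k. X (n + k) s) \<longlonglongrightarrow> x s"
      using LIMSEQ_ignore_initial_segment[OF lim[of s], of n] s r by (simp add: add.commute)
    then have "(\<lambda>k. norm (X (n + k) s - X n s)) \<longlonglongrightarrow> norm (x s - X n s)"
      by (intro tendsto_intros)
    then show ?thesis
      by (rule LIMSEQ_le_const2) (use cauchy[OF s] in auto)
  qed
  \<comment> \<open>The contraction compares \<open>x\<close> with \<open>X n\<close> directly, so
    the limit passes through the state-dependent delay without a separate convergence argument for
    the integrands.\<close>
  have xeq: "x s = w 0 + integral {t..s} (along f x \<alpha>)" if s: "s \<in> {t..t'}" for s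
  proof -
    let ?y = "w 0 + integral {t..s} (along f x \<alpha>)"
    have "norm (?y - X (Suc n) s) \<le> R / 2 ^ n * exp (\<beta> * (s - t))" for n
    proof -
      have "norm (?y - X (Suc n) s) =
          norm (integral {t..s} (along f x \<alpha>) - integral {t..s} (along f (X n) \<alpha>))"
        using s by (simp add: XS picard_after)
      also have "\<dots> \<le> 2 * R / 2 ^ n / 2 * exp (\<beta> * (s - t))"
        using s by (intro integral_along_f_contraction[OF t(1,3) \<alpha> xK XK _ xX \<beta>_def])
          (auto simp: Xhist xhist)
      finally show ?thesis by simp
    qed
    moreover have "(\<lambda>n. R / 2 ^ n * exp (\<beta> * (s - t))) \<longlonglongrightarrow> 0"
      by (rule LIMSEQ_halving_mult_zero)
    moreover have "(\<lambda>n. norm (?y - X (Suc n) s)) \<longlonglongrightarrow> norm (?y - x s)"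
      using s r by (intro tendsto_intros LIMSEQ_Suc lim) auto
    ultimately have "norm (?y - x s) \<le> 0"
      by (intro LIMSEQ_le) auto
    then show ?thesis by simp
  qed
  show thesis
  proof (rule that)
    show "is_trajectory f \<tau> r t t' w \<alpha> x"
      unfolding is_trajectory_iff_integral_equation[OF t \<alpha>]
      using xK xeq by (auto simp: xhist)
    show "norm (x s) \<le> M * exp (3 * Cf * (t' - t))" if "s \<in> {t - r..t'}" for s
    proof -
      have "(\<lambda>n. norm (X n s)) \<longlonglongrightarrow> norm (x s)"
        by (intro tendsto_norm lim that)
      then show ?thesis
        by (rule LIMSEQ_le_const2) (use XR[OF that] in \<open>auto simp: R_def\<close>)
    qed
  qed
qed

end

section \<open>Restriction and concatenation of controls\<close>

lemma controls_subinterval: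
  assumes "\<alpha> \<in> controls A t t'" "t \<le> a" "b \<le> t'"
  shows "\<alpha> \<in> controls A a b"
proof -
  have "{a<..<b} \<subseteq> {t<..<t'}" using assms by auto
  then show ?thesis
    using assms by (auto simp: controls_def intro: measurable_restrict_mono)
qed

lemma controls_cong:
  assumes "\<alpha> \<in> controls A t t'" "\<And>s. s \<in> {t<..<t'} \<Longrightarrow> \<alpha> s = \<beta> s"
  shows "\<beta> \<in> controls A t t'"
proof -
  have "\<beta> \<in> borel_measurable (lebesgue_on {t<..<t'}) \<longleftrightarrow> \<alpha> \<in> borel_measurable (lebesgue_on {t<..<t'})"
    using assms(2) by (intro measurable_cong) auto
  moreover have "\<beta> \<in> {t<..<t'} \<rightarrow> A \<longleftrightarrow> \<alpha> \<in> {t<..<t'} \<rightarrow> A"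
    using assms(2) by (intro Pi_cong) auto
  ultimately show ?thesis
    using assms(1) by (simp add: controls_def)
qed

lemma controls_nonempty: "A \<noteq> {} \<Longrightarrow> controls A t t' \<noteq> {}"
  by (auto simp: controls_def ex_in_conv[symmetric] intro!: exI[of _ "\<lambda>_. SOME a. a \<in> A"] some_in_eq[THEN iffD2])

text \<open>The joining time \<open>t1\<close> belongs to neither open piece, so \<open>a\<close>
  supplies an admissible value there. Measurability comes from a sum of three measurable functions
  that vanish outside disjoint sets.\<close>

lemma controls_concat:
  assumes \<alpha>: "\<alpha> \<in> controls A t t1" and \<beta>: "\<beta> \<in> controls A t1 t'" and a: "a \<in> A"
  shows "(\<lambda>s. if s \<in> {t<..<t1} then \<alpha> s else if s \<in> {t1<..<t'} then \<beta> s else a) \<in> controls A t t'"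
    (is "?\<gamma> \<in> _")
proof -
  have "(\<lambda>s. if s \<in> {t<..<t1} then \<alpha> s else 0) \<in> borel_measurable lebesgue"
    "(\<lambda>s. if s \<in> {t1<..<t'} then \<beta> s else 0) \<in> borel_measurable lebesgue"
    using \<alpha> \<beta> unfolding controls_def by (intro borel_measurable_if_I; force)+
  moreover have "(\<lambda>s. if s \<in> {t<..<t1} \<union> {t1<..<t'} then 0 else a) \<in> borel_measurable lebesgue"
    by (intro measurable_If_set) auto
  ultimately have "(\<lambda>s. (if s \<in> {t<..<t1} then \<alpha> s else 0) + (if s \<in> {t1<..<t'} then \<beta> s else 0) +
      (if s \<in> {t<..<t1} \<union> {t1<..<t'} then 0 else a)) \<in> borel_measurable lebesgue"
    by (intro borel_measurable_add)
  moreover have "(\<lambda>s. (if s \<in> {t<..<t1} then \<alpha> s else 0) + (if s \<in> {t1<..<t'} then \<beta> s else 0) +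
      (if s \<in> {t<..<t1} \<union> {t1<..<t'} then 0 else a)) = ?\<gamma>"
    by (auto simp: fun_eq_iff)
  ultimately have "?\<gamma> \<in> borel_measurable lebesgue" by simp
  then have "?\<gamma> \<in> borel_measurable (lebesgue_on {t<..<t'})"
    by (rule measurable_restrict_space1)
  then show ?thesis
    using \<alpha> \<beta> a by (auto simp: controls_def Pi_iff)
qed

section \<open>Restriction and locality of trajectories\<close>

context delay_dynamics
begin

text \<open>The derivative is prescribed only inside an open interval, where it ignores values
  outside, and delayed times stay in \<open>[t - r, t']\<close>.\<close>

lemma is_trajectory_cong:
  assumes t: "t0 \<le> t" "t' \<le> T"
    and x: "\<And>s. s \<in> {t - r..t'} \<Longrightarrow> x s = y s" and \<alpha>: "\<And>s. s \<in> {t<..<t'} \<Longrightarrow> \<alpha> s = \<beta> s"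
    and w: "\<And>\<theta>. \<theta> \<in> {-r..0} \<Longrightarrow> w \<theta> = v \<theta>" and "t \<le> t'"
    and tr: "is_trajectory f \<tau> r t t' w \<alpha> x"
  shows "is_trajectory f \<tau> r t t' v \<beta> y"
proof -
  have r: "0 \<le> r" using t \<open>t \<le> t'\<close> by (intro r_nonneg) auto
  obtain K where "K-lipschitz_on {t - r..t'} x"
    using tr by (auto simp: is_trajectory_def)
  then have "K-lipschitz_on {t - r..t'} y"
    using x by (simp add: lipschitz_on_def)
  moreover have "(y has_vector_derivative along f y \<beta> s) (at s)"
    if "(x has_vector_derivative along f x \<alpha> s) (at s)" and s: "s \<in> {t<..<t'}" for s
  proof -
    have "s \<in> {t..t'}" using s by auto
    from delayed_time_in[OF t this, of "x s"] have "along f x \<alpha> s = along f y \<beta> s"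
      using x[of s] x[of "s - \<tau> s (x s)"] \<alpha>[of s] s r by auto
    moreover have "(y has_vector_derivative along f x \<alpha> s) (at s)"
      by (rule has_vector_derivative_transform_within_open[OF that(1) _ s]) (use x r in auto)
    ultimately show ?thesis by simp
  qed
  then have "AE s in lebesgue_on {t<..<t'}. (y has_vector_derivative along f y \<beta> s) (at s)"
    using tr by (auto simp: is_trajectory_def AE_restrict_space_iff elim!: eventually_mono)
  moreover have "y (t + \<theta>) = v \<theta>" if "\<theta> \<in> {-r..0}" for \<theta>
    using tr that x[of "t + \<theta>"] w[of \<theta>] \<open>t \<le> t'\<close> by (auto simp: is_trajectory_def)
  ultimately show ?thesis
    unfolding is_trajectory_def by blast
qed

lemma is_trajectory_initial:
  assumes t: "t0 \<le> t" "t \<le> t1" "t1 \<le> t'" "t' \<le> T" and tr: "is_trajectory f \<tau> r t t' w \<alpha> x"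
  shows "is_trajectory f \<tau> r t t1 w \<alpha> x"
proof -
  have "\<exists>K. K-lipschitz_on {t - r..t1} x"
    using tr t unfolding is_trajectory_def by (meson atLeastatMost_subset_iff lipschitz_on_subset order_refl)
  moreover have "AE s in lebesgue_on {t<..<t1}. (x has_vector_derivative along f x \<alpha> s) (at s)"
    using tr t by (auto simp: is_trajectory_def AE_restrict_space_iff elim!: eventually_mono)
  ultimately show ?thesis
    using tr by (simp add: is_trajectory_def)
qed

lemma is_trajectory_final:
  assumes t: "t0 \<le> t" "t \<le> t1" "t1 \<le> t'" "t' \<le> T" and tr: "is_trajectory f \<tau> r t t' w \<alpha> x"
  shows "is_trajectory f \<tau> r t1 t' (hist x t1) \<alpha> x"
proof -
  have "{t1 - r..t'} \<subseteq> {t - r..t'}" using t by auto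
  then have "\<exists>K. K-lipschitz_on {t1 - r..t'} x"
    using tr unfolding is_trajectory_def by (meson lipschitz_on_subset)
  moreover have "AE s in lebesgue_on {t1<..<t'}. (x has_vector_derivative along f x \<alpha> s) (at s)"
    using tr t by (auto simp: is_trajectory_def AE_restrict_space_iff elim!: eventually_mono)
  ultimately show ?thesis
    by (simp add: is_trajectory_def hist_def)
qed

lemma hist_in_lip_hist:
  assumes "is_trajectory f \<tau> r t t' w \<alpha> x" "t \<le> s" "s \<le> t'"
  shows "hist x s \<in> lip_hist r"
proof -
  obtain K where K: "K-lipschitz_on {t - r..t'} x"
    using assms(1) by (auto simp: is_trajectory_def)
  have "K-lipschitz_on {-r..0} (hist x s)"
  proof (rule lipschitz_onI)
    fix u v assume "u \<in> {-r..0}" "v \<in> {-r..0}"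
    then show "dist (hist x s u) (hist x s v) \<le> K * dist u v"
      using lipschitz_onD[OF K, of "s + u" "s + v"] assms by (simp add: hist_def)
  qed (rule lipschitz_on_nonneg[OF K])
  then show ?thesis by (auto simp: lip_hist_def)
qed

lemma trajectory_eq:
  assumes t: "t0 \<le> t" "t \<le> t'" "t' \<le> T" and \<alpha>: "\<alpha> \<in> controls A t t'"
    and x: "is_trajectory f \<tau> r t t' w \<alpha> x"
  shows "trajectory f \<tau> r t t' w \<alpha> = restrict x {t - r..t'}"
  unfolding trajectory_def
proof (rule the_equality)
  show "restrict x {t - r..t'} \<in> extensional {t - r..t'} \<and>
      is_trajectory f \<tau> r t t' w \<alpha> (restrict x {t - r..t'})"
    using is_trajectory_cong[OF t(1,3) _ _ _ t(2) x] by auto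
next
  fix y assume y: "y \<in> extensional {t - r..t'} \<and> is_trajectory f \<tau> r t t' w \<alpha> y"
  then show "y = restrict x {t - r..t'}"
    using is_trajectory_unique[OF t \<alpha> _ x, of y]
    by (intro extensionalityI[of _ "{t - r..t'}"]) auto
qed

lemma trajectory_apply:
  assumes "t0 \<le> t" "t \<le> t'" "t' \<le> T" "\<alpha> \<in> controls A t t'" "is_trajectory f \<tau> r t t' w \<alpha> x"
    and "s \<in> {t - r..t'}"
  shows "trajectory f \<tau> r t t' w \<alpha> s = x s"
  using trajectory_eq[OF assms(1-5)] assms(6) by simp

lemma is_trajectory_trajectory:
  assumes t: "t0 \<le> t" "t \<le> t'" "t' \<le> T" and \<alpha>: "\<alpha> \<in> controls A t t'" and w: "w \<in> lip_hist r"
  shows "is_trajectory f \<tau> r t t' w \<alpha> (trajectory f \<tau> r t t' w \<alpha>)"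
proof -
  obtain M where M: "1 \<le> M" "\<And>\<theta>. \<theta> \<in> {-r..0} \<Longrightarrow> norm (w \<theta>) \<le> M"
    using lip_hist_bounded[OF w] by blast
  obtain x where x: "is_trajectory f \<tau> r t t' w \<alpha> x"
    by (rule is_trajectory_exists[OF t \<alpha> w M])
  show ?thesis
    by (rule is_trajectory_cong[OF t(1,3) _ _ _ t(2) x]) (use trajectory_eq[OF t \<alpha> x] in auto)
qed

lemma norm_trajectory_le:
  assumes t: "t0 \<le> t" "t \<le> t'" "t' \<le> T" and \<alpha>: "\<alpha> \<in> controls A t t'" and w: "w \<in> lip_hist r"
    and M: "1 \<le> M" "\<And>\<theta>. \<theta> \<in> {-r..0} \<Longrightarrow> norm (w \<theta>) \<le> M" and s: "s \<in> {t - r..t'}"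
  shows "norm (trajectory f \<tau> r t t' w \<alpha> s) \<le> M * exp (3 * Cf * (t' - t))"
proof -
  obtain x where x: "is_trajectory f \<tau> r t t' w \<alpha> x"
    "\<And>s. s \<in> {t - r..t'} \<Longrightarrow> norm (x s) \<le> M * exp (3 * Cf * (t' - t))"
    using is_trajectory_exists[OF t \<alpha> w M] by blast
  then show ?thesis
    using trajectory_apply[OF t \<alpha> x(1) s] s by simp
qed

text \<open>The predicates behind the two definite descriptions coincide, so the equality holds
  whether or not a solution exists.\<close>

lemma trajectory_cong:
  assumes t: "t0 \<le> t" "t \<le> t'" "t' \<le> T"
    and \<alpha>: "\<And>s. s \<in> {t<..<t'} \<Longrightarrow> \<alpha> s = \<beta> s" and w: "\<And>\<theta>. \<theta> \<in> {-r..0} \<Longrightarrow> w \<theta> = v \<theta>"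
  shows "trajectory f \<tau> r t t' w \<alpha> = trajectory f \<tau> r t t' v \<beta>"
proof -
  have "is_trajectory f \<tau> r t t' w \<alpha> x \<longleftrightarrow> is_trajectory f \<tau> r t t' v \<beta> x" for x
    using is_trajectory_cong[OF t(1,3) _ _ _ t(2), of x x \<alpha> \<beta> w v]
      is_trajectory_cong[OF t(1,3) _ _ _ t(2), of x x \<beta> \<alpha> v w] \<alpha> w by (metis (no_types, lifting))
  then show ?thesis by (simp add: trajectory_def)
qed

lemma running_cost_cong:
  fixes L :: "real \<Rightarrow> 'a \<Rightarrow> 'a \<Rightarrow> 'b \<Rightarrow> real"
  assumes t: "t0 \<le> t" "t' \<le> T"
    and x: "\<And>s. s \<in> {t - r..t'} \<Longrightarrow> x s = y s" and \<alpha>: "\<And>s. s \<in> {t<..<t'} \<Longrightarrow> \<alpha> s = \<beta> s"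
  shows "running_cost L \<tau> t t' x \<alpha> = running_cost L \<tau> t t' y \<beta>"
  unfolding running_cost_def
proof (rule set_lebesgue_integral_cong)
  show "\<forall>s. s \<in> {t<..<t'} \<longrightarrow> along L x \<alpha> s = along L y \<beta> s"
  proof (intro allI impI)
    fix s assume s: "s \<in> {t<..<t'}"
    then have "s \<in> {t..t'}" "0 \<le> r" using t by (auto intro!: r_nonneg)
    then show "along L x \<alpha> s = along L y \<beta> s"
      using x[of s] x[OF delayed_time_in[OF t, of s "x s"]] \<alpha>[OF s] by auto
  qed
qed simp

end

section \<open>Costs and the dynamic programming principle\<close>

locale delay_control = delay_dynamics t0 T r A f \<tau> lf lt Cf
  for t0 T r :: real and A :: "'b::euclidean_space set"
    and f :: "real \<Rightarrow> 'a::euclidean_space \<Rightarrow> 'a \<Rightarrow> 'b \<Rightarrow> 'a"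
    and \<tau> :: "real \<Rightarrow> 'a \<Rightarrow> real"
    and lf lt Cf :: real +
  fixes L :: "real \<Rightarrow> 'a \<Rightarrow> 'a \<Rightarrow> 'b \<Rightarrow> real" and g :: "'a \<times> (real \<Rightarrow> 'a) \<Rightarrow> real" and CL :: real
  assumes L_cont: "continuous_on ({t0..T} \<times> UNIV \<times> UNIV \<times> A) (\<lambda>(s, z, y, a). L s z y a)"
    and CL_nonneg: "0 \<le> CL"
    and L_growth: "\<lbrakk>s \<in> {t0..T}; a \<in> A\<rbrakk> \<Longrightarrow> \<bar>L s z y a\<bar> \<le> CL * (1 + norm z + norm y)"
    and g_lip: "0 < R \<Longrightarrow> \<exists>lg>0. \<forall>p\<in>state_space r. \<forall>q\<in>state_space r.
        snd p \<in> lip_hist_ball r R \<longrightarrow> snd q \<in> lip_hist_ball r R \<longrightarrow> \<bar>g p - g q\<bar> \<le> lg * state_dist r p q"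
    and t0_le_T: "t0 \<le> T"
begin

lemma r_ge_0: "0 \<le> r"
  using t0_le_T by (rule r_nonneg)

lemma lip_hist_ballI:
  assumes "w \<in> lip_hist r" "\<And>\<theta>. \<theta> \<in> {-r..0} \<Longrightarrow> norm (w \<theta>) \<le> R"
  shows "w \<in> lip_hist_ball r R"
proof -
  have "hist_sup_norm r w \<le> R"
    unfolding hist_sup_norm_def using assms(2) r_ge_0 by (intro cSUP_least) auto
  with assms(1) show ?thesis by (simp add: lip_hist_ball_def)
qed

text \<open>Histories are total functions, and a priori \<open>g\<close> could read their values outside \<open>[-r, 0]\<close>;
  its Lipschitz bound rules this out.\<close>

lemma terminal_cost_cong:
  assumes w: "w \<in> lip_hist r" and v: "v \<in> lip_hist r" and eq: "\<And>\<theta>. \<theta> \<in> {-r..0} \<Longrightarrow> w \<theta> = v \<theta>"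
  shows "g (w 0, w) = g (v 0, v)"
proof -
  obtain R where R: "1 \<le> R" "\<And>\<theta>. \<theta> \<in> {-r..0} \<Longrightarrow> norm (w \<theta>) \<le> R"
    using lip_hist_bounded[OF w] by blast
  have "0 < R" using R by simp
  from g_lip[OF this] obtain lg where "\<bar>g (w 0, w) - g (v 0, v)\<bar> \<le> lg * state_dist r (w 0, w) (v 0, v)"
    using lip_hist_ballI[OF w R(2)] lip_hist_ballI[OF v, of R] R(2) eq w v
    by (fastforce simp: state_space_def)
  moreover have "hist_L1_norm r (\<lambda>\<theta>. w \<theta> - v \<theta>) = (LINT \<theta>:{-r..0}|lebesgue. 0)"
    unfolding hist_L1_norm_def by (rule set_lebesgue_integral_cong) (use eq in auto)
  then have "state_dist r (w 0, w) (v 0, v) = 0"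
    using eq[of 0] r_ge_0 by (simp add: state_dist_def set_lebesgue_integral_def)
  ultimately show ?thesis by simp
qed

text \<open>Comparison with the zero history: its distance to \<open>(w 0, w)\<close> is at most
  \<open>R' + R' * r\<close>, the first term from the end point and the second from the L1
  norm.\<close>

lemma terminal_cost_bounded_below:
  obtains B where "\<And>w. \<lbrakk>w \<in> lip_hist r; \<And>\<theta>. \<theta> \<in> {-r..0} \<Longrightarrow> norm (w \<theta>) \<le> R\<rbrakk> \<Longrightarrow> B \<le> g (w 0, w)"
proof -
  \<comment> \<open>The Lipschitz condition on \<open>g\<close> is available for positive radii,
    while \<open>R\<close> is arbitrary.\<close>
  define R' where "R' = max 1 R"
  then have "0 < R'" by simp
  from g_lip[OF this] obtain lg where "lg > 0" and lg: "\<And>p q. \<lbrakk>p \<in> state_space r; q \<in> state_space r;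
      snd p \<in> lip_hist_ball r R'; snd q \<in> lip_hist_ball r R'\<rbrakk> \<Longrightarrow> \<bar>g p - g q\<bar> \<le> lg * state_dist r p q"
    by blast
  have zero: "(\<lambda>_. 0) \<in> lip_hist r"
    by (auto simp: lip_hist_def lipschitz_on_def)
  have "g (0, \<lambda>_. 0) - lg * (R' + R' * r) \<le> g (w 0, w)"
    if w: "w \<in> lip_hist r" and wR: "\<And>\<theta>. \<theta> \<in> {-r..0} \<Longrightarrow> norm (w \<theta>) \<le> R" for w
  proof -
    have wR': "norm (w \<theta>) \<le> R'" if "\<theta> \<in> {-r..0}" for \<theta>
      using wR[OF that] by (simp add: R'_def)
    have "hist_L1_norm r (\<lambda>\<theta>. w \<theta> - 0) \<le> (LINT \<theta>:{-r..0}|lebesgue. R')"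
      unfolding hist_L1_norm_def set_lebesgue_integral_def
    proof (rule integral_mono')
      show "integrable lebesgue (\<lambda>\<theta>. indicat_real {-r..0} \<theta> *\<^sub>R R')"
        using r_ge_0 by (intro integrable_scaleR_left) (simp add: integrable_indicator_iff)
      show "indicat_real {-r..0} \<theta> *\<^sub>R norm (w \<theta> - 0) \<le> indicat_real {-r..0} \<theta> *\<^sub>R R'" for \<theta>
        using wR'[of \<theta>] by (simp add: indicator_def)
      show "0 \<le> indicat_real {-r..0} \<theta> *\<^sub>R R'" for \<theta>
        using \<open>0 < R'\<close> by simp
    qed
    also have "\<dots> = R' * r"
      using r_ge_0 by (simp add: set_lebesgue_integral_def mult.commute)
    finally have "state_dist r (w 0, w) (0, \<lambda>_. 0) \<le> R' + R' * r"
      using wR'[of 0] r_ge_0 by (simp add: state_dist_def)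
    then have "lg * state_dist r (w 0, w) (0, \<lambda>_. 0) \<le> lg * (R' + R' * r)"
      using \<open>lg > 0\<close> by (intro mult_left_mono) auto
    moreover have "\<bar>g (w 0, w) - g (0, \<lambda>_. 0)\<bar> \<le> lg * state_dist r (w 0, w) (0, \<lambda>_. 0)"
      using w zero \<open>0 < R'\<close> wR'
      by (intro lg) (auto simp: state_space_def intro!: lip_hist_ballI)
    ultimately show ?thesis by linarith
  qed
  then show ?thesis by (rule that)
qed

lemma along_L_absolutely_integrable:
  assumes "t0 \<le> t" "t' \<le> T" "\<alpha> \<in> controls A t t'" "continuous_on {t - r..t'} x"
  shows "along L x \<alpha> absolutely_integrable_on {t<..<t'}"
  by (rule along_absolutely_integrable[OF L_cont _ CL_nonneg assms]) (use L_growth in auto)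

text \<open>The cost integrates over an open interval, the domain of a control. The gauge integral
  over the closed interval gives additivity and the norm bound.\<close>

lemma running_cost_eq_integral:
  assumes "t0 \<le> t" "t' \<le> T" "\<alpha> \<in> controls A t t'" "continuous_on {t - r..t'} x"
  shows "along L x \<alpha> integrable_on {t..t'}"
    and "running_cost L \<tau> t t' x \<alpha> = integral {t..t'} (along L x \<alpha>)"
  using set_lebesgue_integral_eq_integral[OF along_L_absolutely_integrable[OF assms]]
  by (auto simp: running_cost_def integral_open_interval_real integrable_on_open_interval_real)

lemma running_cost_split:
  assumes t: "t0 \<le> t" "t \<le> t1" "t1 \<le> t'" "t' \<le> T" and \<alpha>: "\<alpha> \<in> controls A t t'"
    and x: "continuous_on {t - r..t'} x"
  shows "running_cost L \<tau> t t' x \<alpha> = running_cost L \<tau> t t1 x \<alpha> + running_cost L \<tau> t1 t' x \<alpha>"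
proof -
  have "running_cost L \<tau> t t1 x \<alpha> = integral {t..t1} (along L x \<alpha>)"
    using t controls_subinterval[OF \<alpha>, of t t1]
    by (intro running_cost_eq_integral continuous_on_subset[OF x]) auto
  moreover have "running_cost L \<tau> t1 t' x \<alpha> = integral {t1..t'} (along L x \<alpha>)"
    using t controls_subinterval[OF \<alpha>, of t1 t']
    by (intro running_cost_eq_integral continuous_on_subset[OF x]) auto
  ultimately show ?thesis
    using Henstock_Kurzweil_Integration.integral_combine[OF t(2,3) running_cost_eq_integral(1)[OF t(1,4) \<alpha> x]]
      running_cost_eq_integral(2)[OF t(1,4) \<alpha> x] by simp
qed

lemma running_cost_bounded_below:
  assumes t: "t0 \<le> t" "t \<le> t'" "t' \<le> T" and \<alpha>: "\<alpha> \<in> controls A t t'"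
    and x: "continuous_on {t - r..t'} x" and R: "\<And>s. s \<in> {t - r..t'} \<Longrightarrow> norm (x s) \<le> R"
  shows "- (CL * (1 + 2 * R) * (t' - t)) \<le> running_cost L \<tau> t t' x \<alpha>"
proof -
  have "norm (integral {t..t'} (along L x \<alpha>)) \<le> CL * (1 + 2 * R) * (t' - t)"
  proof (rule norm_integral_le_open_interval)
    show "along L x \<alpha> integrable_on {t..t'}"
      by (rule running_cost_eq_integral(1)[OF t(1,3) \<alpha> x])
    show "((\<lambda>_. CL * (1 + 2 * R)) has_integral CL * (1 + 2 * R) * (t' - t)) {t..t'}"
      using has_integral_const_real[of "CL * (1 + 2 * R)" t t'] t by (simp add: mult.commute)
    fix s assume s: "s \<in> {t<..<t'}"
    then have "s \<in> {t..t'}" "s \<in> {t - r..t'}" using r_ge_0 by auto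
    then have "norm (x s) \<le> R" "norm (x (s - \<tau> s (x s))) \<le> R"
      using delayed_time_in[OF t(1,3)] R by blast+
    then have "CL * (1 + norm (x s) + norm (x (s - \<tau> s (x s)))) \<le> CL * (1 + 2 * R)"
      using CL_nonneg by (intro mult_left_mono) auto
    moreover have "\<bar>along L x \<alpha> s\<bar> \<le> CL * (1 + norm (x s) + norm (x (s - \<tau> s (x s))))"
      using s t \<alpha> by (intro L_growth) (auto simp: controls_def)
    ultimately show "norm (along L x \<alpha> s) \<le> CL * (1 + 2 * R)" by simp
  qed
  then show ?thesis
    by (simp add: running_cost_eq_integral(2)[OF t(1,3) \<alpha> x])
qed

lemma is_trajectory_continuous_on:
  "is_trajectory f \<tau> r t t' w \<alpha> x \<Longrightarrow> continuous_on {t - r..t'} x"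
  unfolding is_trajectory_def using lipschitz_on_continuous_on by blast

section \<open>Total cost and value\<close>

lemma total_cost_cong:
  assumes t: "t0 \<le> t" "t \<le> T"
    and \<alpha>: "\<And>s. s \<in> {t<..<T} \<Longrightarrow> \<alpha> s = \<beta> s" and w: "\<And>\<theta>. \<theta> \<in> {-r..0} \<Longrightarrow> w \<theta> = v \<theta>"
  shows "total_cost T f L g \<tau> r t w \<alpha> = total_cost T f L g \<tau> r t v \<beta>"
proof -
  have "trajectory f \<tau> r t T w \<alpha> = trajectory f \<tau> r t T v \<beta>"
    by (rule trajectory_cong[OF t order_refl]) (use \<alpha> w in auto)
  moreover have "running_cost L \<tau> t T x \<alpha> = running_cost L \<tau> t T x \<beta>" for x
    by (rule running_cost_cong[OF t(1) order_refl]) (use \<alpha> in auto)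
  ultimately show ?thesis by (simp add: total_cost_def)
qed

lemma terminal_cost_eq:
  assumes "is_trajectory f \<tau> r t T w \<alpha> x" "is_trajectory f \<tau> r t1 T v \<beta> y" "t \<le> t1" "t1 \<le> T"
    and "\<And>s. s \<in> {t1 - r..T} \<Longrightarrow> x s = y s"
  shows "g (x T, hist x T) = g (y T, hist y T)"
  using terminal_cost_cong[OF hist_in_lip_hist[OF assms(1)] hist_in_lip_hist[OF assms(2)], of T T] assms
  by (simp add: hist_def)

text \<open>The same total function \<open>\<alpha>\<close> serves on both pieces, and uniqueness
  identifies each piece with a restriction of the trajectory over \<open>[t, T]\<close>. The first
  trajectory is the one that stops at \<open>t1\<close>, to match \<open>dpp_cost\<close>.\<close>

lemma total_cost_split:
  assumes t: "t0 \<le> t" "t \<le> t1" "t1 \<le> T" and \<alpha>: "\<alpha> \<in> controls A t T" and w: "w \<in> lip_hist r"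
  defines "y \<equiv> trajectory f \<tau> r t t1 w \<alpha>"
  shows "total_cost T f L g \<tau> r t w \<alpha> =
    running_cost L \<tau> t t1 y \<alpha> + total_cost T f L g \<tau> r t1 (hist y t1) \<alpha>"
proof -
  have tT: "t \<le> T" "t0 \<le> t1" using t by auto
  have \<alpha>1: "\<alpha> \<in> controls A t t1" and \<alpha>2: "\<alpha> \<in> controls A t1 T"
    using t by (auto intro: controls_subinterval[OF \<alpha>])
  define x where "x = trajectory f \<tau> r t T w \<alpha>"
  have x: "is_trajectory f \<tau> r t T w \<alpha> x"
    unfolding x_def by (rule is_trajectory_trajectory[OF t(1) tT(1) order_refl \<alpha> w])
  have yx: "y s = x s" if "s \<in> {t - r..t1}" for s
    unfolding y_def
    by (rule trajectory_apply[OF t(1,2,3) \<alpha>1 is_trajectory_initial[OF t order_refl x] that])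
  have z: "is_trajectory f \<tau> r t1 T (hist y t1) \<alpha> x"
    by (rule is_trajectory_cong[OF tT(2) order_refl _ _ _ t(3) is_trajectory_final[OF t order_refl x]])
      (use t yx in \<open>auto simp: hist_def\<close>)
  define z where "z = trajectory f \<tau> r t1 T (hist y t1) \<alpha>"
  have zx: "z s = x s" if "s \<in> {t1 - r..T}" for s
    unfolding z_def by (rule trajectory_apply[OF tT(2) t(3) order_refl \<alpha>2 z that])
  have "is_trajectory f \<tau> r t1 T (hist y t1) \<alpha> z"
    by (rule is_trajectory_cong[OF tT(2) order_refl _ _ _ t(3) z]) (use zx in auto)
  \<comment> \<open>As total functions, the histories of \<open>z\<close> and \<open>x\<close> at
    \<open>T\<close> may differ outside \<open>[-r, 0]\<close>, so this equality rests on the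
    locality of \<open>g\<close>.\<close>
  then have "g (z T, hist z T) = g (x T, hist x T)"
    using terminal_cost_eq[OF x _ t(2,3), of _ \<alpha> z] zx by auto
  moreover have "running_cost L \<tau> t1 T z \<alpha> = running_cost L \<tau> t1 T x \<alpha>"
    by (rule running_cost_cong[OF tT(2) order_refl]) (use zx in auto)
  moreover have "running_cost L \<tau> t t1 y \<alpha> = running_cost L \<tau> t t1 x \<alpha>"
    by (rule running_cost_cong[OF t(1,3)]) (use yx in auto)
  moreover have "running_cost L \<tau> t T x \<alpha> = running_cost L \<tau> t t1 x \<alpha> + running_cost L \<tau> t1 T x \<alpha>"
    by (rule running_cost_split[OF t order_refl \<alpha> is_trajectory_continuous_on[OF x]])
  ultimately show ?thesis
    by (simp add: total_cost_def Let_def flip: x_def z_def)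
qed

lemma total_cost_bdd_below:
  assumes t: "t0 \<le> t" "t \<le> T" and w: "w \<in> lip_hist r"
  shows "bdd_below (total_cost T f L g \<tau> r t w ` controls A t T)"
proof -
  obtain M where M: "1 \<le> M" "\<And>\<theta>. \<theta> \<in> {-r..0} \<Longrightarrow> norm (w \<theta>) \<le> M"
    using lip_hist_bounded[OF w] by blast
  define R where "R = M * exp (3 * Cf * (T - t))"
  obtain B where B: "\<And>v. \<lbrakk>v \<in> lip_hist r; \<And>\<theta>. \<theta> \<in> {-r..0} \<Longrightarrow> norm (v \<theta>) \<le> R\<rbrakk> \<Longrightarrow> B \<le> g (v 0, v)"
    by (rule terminal_cost_bounded_below[of R]) blast
  have "- (CL * (1 + 2 * R) * (T - t)) + B \<le> total_cost T f L g \<tau> r t w \<alpha>"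
    if \<alpha>: "\<alpha> \<in> controls A t T" for \<alpha>
  proof -
    define x where "x = trajectory f \<tau> r t T w \<alpha>"
    have x: "is_trajectory f \<tau> r t T w \<alpha> x"
      unfolding x_def by (rule is_trajectory_trajectory[OF t order_refl \<alpha> w])
    have xR: "norm (x s) \<le> R" if "s \<in> {t - r..T}" for s
      unfolding x_def R_def by (rule norm_trajectory_le[OF t order_refl \<alpha> w M that])
    have "B \<le> g (hist x T 0, hist x T)"
      by (intro B hist_in_lip_hist[OF x] t order_refl) (use xR t in \<open>auto simp: hist_def\<close>)
    moreover have "- (CL * (1 + 2 * R) * (T - t)) \<le> running_cost L \<tau> t T x \<alpha>"
      by (rule running_cost_bounded_below[OF t order_refl \<alpha> is_trajectory_continuous_on[OF x] xR])
    ultimately show ?thesis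
      by (simp add: total_cost_def Let_def hist_def flip: x_def)
  qed
  then show ?thesis by (rule bdd_belowI2)
qed

text \<open>At \<open>t = T\<close> every control has zero running cost and the terminal cost of
  \<open>w\<close>, so the infimum is that of a constant. This lets \<open>t + h = T\<close> be
  treated like any other intermediate time.\<close>

lemma value_function_eq_INF:
  assumes t: "t0 \<le> t" "t \<le> T" and w: "w \<in> lip_hist r"
  shows "value_function T A f L g \<tau> r t w = (INF \<alpha>\<in>controls A t T. total_cost T f L g \<tau> r t w \<alpha>)"
proof (cases "t = T")
  case True
  have "total_cost T f L g \<tau> r t w \<alpha> = g (w 0, w)" if \<alpha>: "\<alpha> \<in> controls A t T" for \<alpha>
  proof -
    define x where "x = trajectory f \<tau> r t T w \<alpha>"
    have x: "is_trajectory f \<tau> r t T w \<alpha> x"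
      unfolding x_def by (rule is_trajectory_trajectory[OF t order_refl \<alpha> w])
    have "hist x T \<theta> = w \<theta>" if "\<theta> \<in> {-r..0}" for \<theta>
      using x that True by (simp add: is_trajectory_def hist_def)
    then have "g (hist x T 0, hist x T) = g (w 0, w)"
      by (intro terminal_cost_cong hist_in_lip_hist[OF x] t order_refl w) auto
    moreover have "running_cost L \<tau> t T x \<alpha> = 0"
      using True by (simp add: running_cost_def set_lebesgue_integral_def)
    ultimately show ?thesis
      by (simp add: total_cost_def Let_def hist_def flip: x_def)
  qed
  then have "(INF \<alpha>\<in>controls A t T. total_cost T f L g \<tau> r t w \<alpha>) = (INF \<alpha>\<in>controls A t T. g (w 0, w))"
    by (intro INF_cong) auto
  then show ?thesis
    using True controls_nonempty[OF A_nonempty] by (simp add: value_function_def)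
qed (simp add: value_function_def)

lemma value_function_le_total_cost:
  assumes "t0 \<le> t" "t \<le> T" "w \<in> lip_hist r" "\<alpha> \<in> controls A t T"
  shows "value_function T A f L g \<tau> r t w \<le> total_cost T f L g \<tau> r t w \<alpha>"
  using assms by (simp add: value_function_eq_INF cINF_lower total_cost_bdd_below)

section \<open>The two inequalities at an intermediate time\<close>

lemma dpp_cost_cong:
  assumes "t0 \<le> t" "0 \<le> h" "t + h \<le> T" "\<And>s. s \<in> {t<..<t + h} \<Longrightarrow> \<alpha> s = \<beta> s"
  shows "dpp_cost T A f L g \<tau> r t h w \<alpha> = dpp_cost T A f L g \<tau> r t h w \<beta>"
proof -
  have "trajectory f \<tau> r t (t + h) w \<alpha> = trajectory f \<tau> r t (t + h) w \<beta>"
    using assms by (intro trajectory_cong) auto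
  then show ?thesis
    using running_cost_cong[OF assms(1,3) _ assms(4)] by (simp add: dpp_cost_def Let_def)
qed

text \<open>The tail of \<open>\<alpha>\<close> is one competitor in the infimum defining the value
  at \<open>t + h\<close>.\<close>

lemma dpp_cost_le_total_cost:
  assumes t: "t0 \<le> t" "0 \<le> h" "t + h \<le> T" and \<alpha>: "\<alpha> \<in> controls A t T" and w: "w \<in> lip_hist r"
  shows "dpp_cost T A f L g \<tau> r t h w \<alpha> \<le> total_cost T f L g \<tau> r t w \<alpha>"
proof -
  have t': "t \<le> t + h" "t0 \<le> t + h" using t by auto
  have \<alpha>1: "\<alpha> \<in> controls A t (t + h)" and \<alpha>2: "\<alpha> \<in> controls A (t + h) T"
    using t by (auto intro: controls_subinterval[OF \<alpha>])
  show ?thesis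
    unfolding dpp_cost_def Let_def total_cost_split[OF t(1) t'(1) t(3) \<alpha> w]
    by (intro add_left_mono value_function_le_total_cost t t' \<alpha>2
        hist_in_lip_hist[OF is_trajectory_trajectory[OF t(1) t'(1) t(3) \<alpha>1 w]] order_refl)
qed

text \<open>Concatenation with an arbitrary tail \<open>\<beta>\<close> makes the value minus the
  running cost up to \<open>t + h\<close> a lower bound for the tail costs. It does not depend on
  \<open>\<beta>\<close>, so it passes to their infimum.\<close>

lemma value_function_le_dpp_cost:
  assumes t: "t0 \<le> t" "0 \<le> h" "t + h \<le> T" and \<alpha>: "\<alpha> \<in> controls A t (t + h)" and w: "w \<in> lip_hist r"
  shows "value_function T A f L g \<tau> r t w \<le> dpp_cost T A f L g \<tau> r t h w \<alpha>"
proof -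
  have t': "t \<le> t + h" "t0 \<le> t + h" "t \<le> T" using t by auto
  obtain a where "a \<in> A" using A_nonempty by blast
  define y where "y = trajectory f \<tau> r t (t + h) w \<alpha>"
  have v: "hist y (t + h) \<in> lip_hist r"
    unfolding y_def
    by (rule hist_in_lip_hist[OF is_trajectory_trajectory[OF t(1) t'(1) t(3) \<alpha> w] t'(1) order_refl])
  have "value_function T A f L g \<tau> r t w - running_cost L \<tau> t (t + h) y \<alpha>
      \<le> total_cost T f L g \<tau> r (t + h) (hist y (t + h)) \<beta>" if \<beta>: "\<beta> \<in> controls A (t + h) T" for \<beta>
  proof -
    define \<gamma> where "\<gamma> s = (if s \<in> {t<..<t + h} then \<alpha> s else if s \<in> {t + h<..<T} then \<beta> s else a)" for s
    have \<gamma>: "\<gamma> \<in> controls A t T"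
      unfolding \<gamma>_def by (rule controls_concat[OF \<alpha> \<beta> \<open>a \<in> A\<close>])
    have "trajectory f \<tau> r t (t + h) w \<gamma> = y"
      unfolding y_def by (rule trajectory_cong[OF t(1) t'(1) t(3)]) (auto simp: \<gamma>_def)
    moreover have "running_cost L \<tau> t (t + h) y \<gamma> = running_cost L \<tau> t (t + h) y \<alpha>"
      by (rule running_cost_cong[OF t(1,3)]) (auto simp: \<gamma>_def)
    moreover have "total_cost T f L g \<tau> r (t + h) (hist y (t + h)) \<gamma> =
        total_cost T f L g \<tau> r (t + h) (hist y (t + h)) \<beta>"
      by (rule total_cost_cong[OF t'(2) t(3)]) (auto simp: \<gamma>_def)
    ultimately show ?thesis
      using value_function_le_total_cost[OF t(1) t'(3) w \<gamma>] total_cost_split[OF t(1) t'(1) t(3) \<gamma> w]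
      by simp
  qed
  then have "value_function T A f L g \<tau> r t w - running_cost L \<tau> t (t + h) y \<alpha>
      \<le> value_function T A f L g \<tau> r (t + h) (hist y (t + h))"
    unfolding value_function_eq_INF[OF t'(2) t(3) v]
    by (intro cINF_greatest controls_nonempty A_nonempty)
  then show ?thesis
    by (simp add: dpp_cost_def Let_def flip: y_def)
qed

theorem dynamic_programming_principle:
  assumes t: "t0 \<le> t" "0 \<le> h" "t + h \<le> T" and w: "w \<in> lip_hist r"
  shows "value_function T A f L g \<tau> r t w =
    (INF \<alpha>\<in>controls A t (t + h). dpp_cost T A f L g \<tau> r t h w \<alpha>)" (is "?V = ?I")
proof (rule antisym)
  have tT: "t \<le> T" using t by auto
  show "?V \<le> ?I"
    by (intro cINF_greatest controls_nonempty A_nonempty value_function_le_dpp_cost[OF t _ w])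
  \<comment> \<open>The first inequality also supplies the lower bound that this infimum
    needs.\<close>
  have "bdd_below (dpp_cost T A f L g \<tau> r t h w ` controls A t (t + h))"
    by (rule bdd_belowI2[of _ ?V]) (rule value_function_le_dpp_cost[OF t _ w])
  then have "?I \<le> total_cost T f L g \<tau> r t w \<alpha>" if \<alpha>: "\<alpha> \<in> controls A t T" for \<alpha>
    using t dpp_cost_le_total_cost[OF t \<alpha> w] controls_subinterval[OF \<alpha>, of t "t + h"]
    by (intro order_trans[OF cINF_lower]) auto
  then show "?I \<le> ?V"
    unfolding value_function_eq_INF[OF t(1) tT w]
    by (intro cINF_greatest controls_nonempty A_nonempty)
qed

text \<open>The value is at most the cost at the intermediate time, which is at most the total cost;
  for an optimal control both ends coincide. Restriction changes nothing because only control values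
  in \<open>(t, t + h)\<close> enter.\<close>

theorem optimal_control_restrict:
  assumes t: "t0 \<le> t" "0 \<le> h" "t + h \<le> T" and w: "w \<in> lip_hist r"
    and opt: "optimal_control T A f L g \<tau> r t w \<alpha>"
  shows "restrict \<alpha> {t<..<t + h} \<in> controls A t (t + h)"
    and "dpp_cost T A f L g \<tau> r t h w (restrict \<alpha> {t<..<t + h}) = value_function T A f L g \<tau> r t w"
proof -
  have \<alpha>: "\<alpha> \<in> controls A t T"
    using opt by (simp add: optimal_control_def)
  show res: "restrict \<alpha> {t<..<t + h} \<in> controls A t (t + h)"
    by (rule controls_cong[OF controls_subinterval[OF \<alpha>]]) (use t in auto)
  have "dpp_cost T A f L g \<tau> r t h w (restrict \<alpha> {t<..<t + h}) = dpp_cost T A f L g \<tau> r t h w \<alpha>"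
    by (rule dpp_cost_cong[OF t]) simp
  then show "dpp_cost T A f L g \<tau> r t h w (restrict \<alpha> {t<..<t + h}) = value_function T A f L g \<tau> r t w"
    using dpp_cost_le_total_cost[OF t \<alpha> w] value_function_le_dpp_cost[OF t res w] opt
    by (simp add: optimal_control_def)
qed

end

section \<open>Deriving the constants from the standing assumptions\<close>

theorem theorem3p1:
  fixes t0 T t h \<tau>bar :: real
    and A :: "(real ^ 'm) set"
    and f :: "real \<Rightarrow> real ^ 'n \<Rightarrow> real ^ 'n \<Rightarrow> real ^ 'm \<Rightarrow> real ^ 'n"
    and L :: "real \<Rightarrow> real ^ 'n \<Rightarrow> real ^ 'n \<Rightarrow> real ^ 'm \<Rightarrow> real"
    and g :: "(real ^ 'n) \<times> (real \<Rightarrow> real ^ 'n) \<Rightarrow> real"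
    and \<tau> \<tau>\<^sub>t :: "real \<Rightarrow> real ^ 'n \<Rightarrow> real"
    and \<tau>\<^sub>z :: "real \<Rightarrow> real ^ 'n \<Rightarrow> real ^ 'n"
    and w :: "real \<Rightarrow> real ^ 'n"
  assumes "t0 < T"
    and "A \<noteq> {}" "convex A" "compact A"
    and f_cont: "continuous_on ({t0..T} \<times> UNIV \<times> UNIV \<times> A) (\<lambda>(s, z, y, a). f s z y a)"
    and L_cont: "continuous_on ({t0..T} \<times> UNIV \<times> UNIV \<times> A) (\<lambda>(s, z, y, a). L s z y a)"
    and f_lip: "\<exists>lf>0. \<forall>s\<in>{t0..T}. \<forall>z y z' y'. \<forall>a\<in>A.
        norm (f s z y a - f s z' y' a) \<le> lf * (norm (z - z') + norm (y - y'))"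
    and fL_convex: "\<forall>s\<in>{t0..T}. \<forall>z y. convex {(f s z y a, l) | a l. a \<in> A \<and> L s z y a \<le> l}"
    and L_lip: "\<forall>R>0. \<exists>lL>0. \<forall>s\<in>{t0..T}. \<forall>a\<in>A.
        \<forall>z\<in>cball 0 R. \<forall>y\<in>cball 0 R. \<forall>z'\<in>cball 0 R. \<forall>y'\<in>cball 0 R.
        \<bar>L s z y a - L s z' y' a\<bar> \<le> lL * (norm (z - z') + norm (y - y'))"
    and L_growth: "\<exists>CL>0. \<forall>s\<in>{t0..T}. \<forall>z y. \<forall>a\<in>A. \<bar>L s z y a\<bar> \<le> CL * (1 + norm z + norm y)"
    and \<tau>_nonneg: "\<forall>s\<in>{t0..T}. \<forall>z. 0 \<le> \<tau> s z"
    and \<tau>_bdd: "bdd_above ((\<lambda>(s, z). \<tau> s z) ` ({t0..T} \<times> UNIV))"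
    and \<tau>bar: "\<tau>bar = (SUP (s, z)\<in>{t0..T} \<times> UNIV. \<tau> s z)"
    and \<tau>_deriv: "\<forall>s\<in>{t0..T}. \<forall>z. ((\<lambda>(s, z). \<tau> s z) has_derivative
        (\<lambda>(\<sigma>, \<zeta>). \<tau>\<^sub>t s z * \<sigma> + \<tau>\<^sub>z s z \<bullet> \<zeta>)) (at (s, z) within {t0..T} \<times> UNIV)"
    and \<tau>\<^sub>t_cont: "continuous_on ({t0..T} \<times> UNIV) (\<lambda>(s, z). \<tau>\<^sub>t s z)"
    and \<tau>\<^sub>z_cont: "continuous_on ({t0..T} \<times> UNIV) (\<lambda>(s, z). \<tau>\<^sub>z s z)"
    and \<tau>_lip: "\<exists>lt>0. \<forall>s\<in>{t0..T}. \<forall>z y. \<bar>\<tau> s z - \<tau> s y\<bar> \<le> lt * norm (z - y)"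
    and g_lip: "\<forall>R>0. \<exists>lg>0. \<forall>p\<in>state_space \<tau>bar. \<forall>q\<in>state_space \<tau>bar.
        snd p \<in> lip_hist_ball \<tau>bar R \<longrightarrow> snd q \<in> lip_hist_ball \<tau>bar R \<longrightarrow>
        \<bar>g p - g q\<bar> \<le> lg * state_dist \<tau>bar p q"
    and monotone_delay: "\<forall>\<rho>>0. \<exists>d>0. \<forall>s0\<in>{t0..T}. \<forall>v\<in>lip_hist_ball \<tau>bar \<rho>. \<forall>\<alpha>\<in>controls A s0 T.
        \<forall>x. is_trajectory f \<tau> \<tau>bar s0 T v \<alpha> x \<longrightarrow>
          (AE s in lebesgue_on {s0..T}.
             1 - \<tau>\<^sub>t s (x s) - \<tau>\<^sub>z s (x s) \<bullet> vector_derivative x (at s) \<ge> d)"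
    and "t \<in> {t0..T}" "w \<in> lip_hist \<tau>bar" "t < T" "0 < h" "t + h \<le> T"
  shows "value_function T A f L g \<tau> \<tau>bar t w =
           (INF \<alpha>\<in>controls A t (t + h). dpp_cost T A f L g \<tau> \<tau>bar t h w \<alpha>)
       \<and> (\<forall>\<alpha>. optimal_control T A f L g \<tau> \<tau>bar t w \<alpha> \<longrightarrow>
            restrict \<alpha> {t<..<t + h} \<in> controls A t (t + h) \<and>
            dpp_cost T A f L g \<tau> \<tau>bar t h w (restrict \<alpha> {t<..<t + h}) =
              (INF \<alpha>\<in>controls A t (t + h). dpp_cost T A f L g \<tau> \<tau>bar t h w \<alpha>))"
proof -
  obtain lf where lf: "lf > 0" "\<And>s z y z' y' a. \<lbrakk>s \<in> {t0..T}; a \<in> A\<rbrakk> \<Longrightarrow>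
      norm (f s z y a - f s z' y' a) \<le> lf * (norm (z - z') + norm (y - y'))"
    using f_lip by blast
  obtain CL where CL: "CL > 0" "\<And>s z y a. \<lbrakk>s \<in> {t0..T}; a \<in> A\<rbrakk> \<Longrightarrow> \<bar>L s z y a\<bar> \<le> CL * (1 + norm z + norm y)"
    using L_growth by blast
  obtain lt where lt: "lt > 0" "\<And>s z y. s \<in> {t0..T} \<Longrightarrow> \<bar>\<tau> s z - \<tau> s y\<bar> \<le> lt * norm (z - y)"
    using \<tau>_lip by blast
  \<comment> \<open>Linear growth of \<open>f\<close> follows from its Lipschitz condition once
    \<open>f s 0 0 a\<close> is bounded, which compactness of \<open>{t0..T} \<times> A\<close>
    provides.\<close>
  have "continuous_on ({t0..T} \<times> A) (\<lambda>p. f (fst p) 0 0 (snd p))"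
  proof -
    have "continuous_on ({t0..T} \<times> A) (\<lambda>p. (fst p, 0, 0, snd p))"
      by (intro continuous_intros)
    moreover have "(\<lambda>p. (fst p, 0, 0, snd p)) ` ({t0..T} \<times> A) \<subseteq> {t0..T} \<times> UNIV \<times> UNIV \<times> A"
      by auto
    ultimately show ?thesis
      using continuous_on_compose2[OF f_cont] by fastforce
  qed
  then have "bounded ((\<lambda>p. f (fst p) 0 0 (snd p)) ` ({t0..T} \<times> A))"
    using \<open>compact A\<close> by (intro compact_imp_bounded compact_continuous_image compact_Times) auto
  then obtain B where B: "\<And>s a. \<lbrakk>s \<in> {t0..T}; a \<in> A\<rbrakk> \<Longrightarrow> norm (f s 0 0 a) \<le> B"
    unfolding bounded_iff by fastforce
  \<comment> \<open>The absolute value of \<open>B\<close> keeps the growth constant positive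
    whatever the sign of the chosen bound.\<close>
  have f_growth: "norm (f s z y a) \<le> (lf + \<bar>B\<bar>) * (1 + norm z + norm y)" if sa: "s \<in> {t0..T}" "a \<in> A" for s z y a
  proof -
    have "norm (f s z y a) \<le> norm (f s z y a - f s 0 0 a) + norm (f s 0 0 a)"
      using norm_triangle_ineq[of "f s z y a - f s 0 0 a" "f s 0 0 a"] by simp
    also have "\<dots> \<le> lf * (norm z + norm y) + \<bar>B\<bar>"
      using lf(2)[OF sa, of z y 0 0] B[OF sa] by simp
    also have "\<dots> \<le> (lf + \<bar>B\<bar>) * (1 + norm z + norm y)"
      using lf(1) mult_nonneg_nonneg[of "\<bar>B\<bar>" "norm z + norm y"] by (simp add: algebra_simps)
    finally show ?thesis .
  qed
  have \<tau>_cont: "continuous_on ({t0..T} \<times> UNIV) (\<lambda>(s, z). \<tau> s z)"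
    unfolding continuous_on_eq_continuous_within
  proof
    fix p assume "p \<in> {t0..T} \<times> (UNIV :: (real ^ 'n) set)"
    then obtain s z where "p = (s, z)" "s \<in> {t0..T}" by auto
    with \<tau>_deriv show "continuous (at p within {t0..T} \<times> UNIV) (\<lambda>(s, z). \<tau> s z)"
      by (blast intro: has_derivative_continuous)
  qed
  have \<tau>_le: "\<tau> s z \<le> \<tau>bar" if "s \<in> {t0..T}" for s z
    unfolding \<tau>bar using cSUP_upper[OF _ \<tau>_bdd, of "(s, z)"] that by simp
  interpret delay_control t0 T \<tau>bar A f \<tau> lf lt "lf + \<bar>B\<bar>" L g CL
  proof unfold_locales
    show "0 < lf + \<bar>B\<bar>" using lf(1) by simp
    show "0 \<le> \<tau> s z" if "s \<in> {t0..T}" for s z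
      using \<tau>_nonneg that by blast
    show "0 \<le> lt" "0 \<le> CL" "t0 \<le> T" using lt(1) CL(1) \<open>t0 < T\<close> by auto
  qed (fact assms(2) f_cont L_cont lf lt(2) CL(2) f_growth \<tau>_cont \<tau>_le | use g_lip in blast)+
  have t: "t0 \<le> t" "0 \<le> h" "t + h \<le> T"
    using \<open>t \<in> {t0..T}\<close> \<open>0 < h\<close> \<open>t + h \<le> T\<close> by auto
  note dpp = dynamic_programming_principle[OF t \<open>w \<in> lip_hist \<tau>bar\<close>]
  \<comment> \<open>Rewriting the infimum back into the value reduces attainment to
    \<open>optimal_control_restrict\<close>.\<close>
  show ?thesis
    using dpp optimal_control_restrict[OF t \<open>w \<in> lip_hist \<tau>bar\<close>] by (auto simp flip: dpp)
qed

end
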